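(* Let $C_1,c_1,\gamma>0$, let $E$ be an $m\times n$ real random matrix that is $(C_1,c_1,\gamma)$-concentrated, let $A$ be a deterministic real $m\times n$ matrix of rank $r$, and let $1\le j\le r$ be an integer. Let $\delta_j=\sigma_j-\sigma_{j+1}$. Then, for any $t>0$, $$\sin\angle(v_j,v_j')\le4\sqrt2\left(\left(\sum_{i=1}^{j-1}\sin^2\angle(v_i,v_i')\right)^{1/2}+\frac{t\,r^{1/\gamma}}{\delta_j}+\frac{\|E\|^2}{\sigma_j\delta_j}+\frac{\|E\|}{\sigma_j}\right)$$ with probability at least $$1-6C_1\,9^{j}\exp\left(-c_1\frac{\delta_j^\gamma}{8^\gamma}\right)-2C_1\,9^{2r}\exp\left(-c_1r\frac{t^\gamma}{4^\gamma}\right).$$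
   Context: An $m\times n$ random matrix $E$ is $(C_1,c_1,\gamma)$-concentrated if for all unit vectors $u\in\mathbb R^m$, $v\in\mathbb R^n$ and every $t>0$, $\mathbb P(|u^{\mathrm T}Ev|>t)\le C_1\exp(-c_1t^\gamma)$. $\|\cdot\|$ is the spectral norm. $\sigma_1\ge\cdots\ge\sigma_{\min\{m,n\}}\ge0$ are the singular values of $A$ with corresponding orthonormal singular vectors $v_1,v_2,\dots$, and $\sigma_k:=0$ for $k>\min\{m,n\}$; $v_1',v_2',\dots$ are orthonormal singular vectors of $A+E$ corresponding to its singular values $\sigma_1'\ge\sigma_2'\ge\cdots$. "Singular vectors" may be read as left-singular or as right-singular, the same choice being made throughout; the result holds for either choice. For unit vectors, $\angle(v,v')\in[0,\pi/2]$ and $\sin\angle(v,v')=\sqrt{1-(v\cdot v')^2}$. A quotient with zero denominator is read as $+\infty$. *)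

theory Defs
  imports "HOL-Probability.Probability"
begin

definition concentrated ::
  "'a measure \<Rightarrow> ('a \<Rightarrow> real^'n^'m) \<Rightarrow> real \<Rightarrow> real \<Rightarrow> real \<Rightarrow> bool" where
  "concentrated M E C\<^sub>1 c\<^sub>1 \<gamma> \<longleftrightarrow>
    (\<forall>u v. norm u = 1 \<longrightarrow> norm v = 1 \<longrightarrow>
      (\<forall>t>0. measure M {\<omega> \<in> space M. \<bar>u \<bullet> (E \<omega> *v v)\<bar> > t} \<le> C\<^sub>1 * exp (- c\<^sub>1 * t powr \<gamma>)))"

definition orthonormal_family :: "nat set \<Rightarrow> (nat \<Rightarrow> 'b::real_inner) \<Rightarrow> bool" where
  "orthonormal_family I x \<longleftrightarrow> (\<forall>i\<in>I. \<forall>k\<in>I. x i \<bullet> x k = (if i = k then 1 else 0))"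

text \<open>
  The values \<open>\<sigma> 1 \<ge> \<sigma> 2 \<ge> \<dots> \<ge> 0\<close> are the singular values of \<open>A\<close> and \<open>u\<close>, \<open>v\<close> are corresponding
  orthonormal left and right singular vectors. Indices start at 1; \<open>\<sigma> 0\<close> is irrelevant. Since
  there are \<open>min m n\<close> pairs, \<open>u\<close> or \<open>v\<close> is an orthonormal basis, so these equations amount to
  \<open>A = (\<Sum>i. \<sigma> i u i (v i)\<^sup>T)\<close> and all singular values are listed with multiplicity.
\<close>
definition singular_system ::
  "real^'n^'m \<Rightarrow> (nat \<Rightarrow> real) \<Rightarrow> (nat \<Rightarrow> real^'m) \<Rightarrow> (nat \<Rightarrow> real^'n) \<Rightarrow> bool" where
  "singular_system A \<sigma> u v \<longleftrightarrow>
    (\<forall>i\<ge>1. 0 \<le> \<sigma> i) \<and>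
    (\<forall>i\<ge>1. \<forall>k\<ge>i. \<sigma> k \<le> \<sigma> i) \<and>
    (\<forall>i>min CARD('m) CARD('n). \<sigma> i = 0) \<and>
    orthonormal_family {1..min CARD('m) CARD('n)} u \<and>
    orthonormal_family {1..min CARD('m) CARD('n)} v \<and>
    (\<forall>i\<in>{1..min CARD('m) CARD('n)}. A *v v i = \<sigma> i *\<^sub>R u i \<and> transpose A *v u i = \<sigma> i *\<^sub>R v i)"

definition spectral_norm :: "real^'n^'m \<Rightarrow> real" where
  "spectral_norm A = onorm (\<lambda>x. A *v x)"

text \<open>The angle in \<open>[0, \<pi>/2]\<close> between the lines spanned by two unit vectors.\<close>
definition line_angle :: "'b::real_inner \<Rightarrow> 'b \<Rightarrow> real" where
  "line_angle x y = arccos \<bar>x \<bullet> y\<bar>"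

lemma sin_line_angle:
  assumes "norm x = 1" "norm y = 1"
  shows "sin (line_angle x y) = sqrt (1 - (x \<bullet> y)\<^sup>2)"
proof -
  have "\<bar>x \<bullet> y\<bar> \<le> 1"
    using Cauchy_Schwarz_ineq2[of x y] assms by simp
  then show ?thesis
    by (simp add: line_angle_def sin_arccos)
qed

definition quot_inf :: "real \<Rightarrow> real \<Rightarrow> ereal" where
  "quot_inf x y = (if y = 0 then \<infinity> else ereal (x / y))"

text \<open>
  The set of outcomes satisfying \<open>P\<close> need not be measurable (for instance when \<open>P\<close> involves an
  arbitrary choice of singular vectors), so the probability bound is required of an event on
  which \<open>P\<close> holds.
\<close>
definition holds_with_prob_ge :: "'a measure \<Rightarrow> ('a \<Rightarrow> bool) \<Rightarrow> real \<Rightarrow> bool" where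
  "holds_with_prob_ge M P p \<longleftrightarrow> (\<exists>F\<in>sets M. (\<forall>\<omega>\<in>F. P \<omega>) \<and> p \<le> measure M F)"

lemma holds_with_prob_ge_iff:
  assumes "prob_space M" and "{\<omega> \<in> space M. P \<omega>} \<in> sets M"
  shows "holds_with_prob_ge M P p \<longleftrightarrow> p \<le> measure M {\<omega> \<in> space M. P \<omega>}"
proof
  interpret prob_space M by fact
  assume "holds_with_prob_ge M P p"
  then obtain F where F: "F \<in> sets M" "\<forall>\<omega>\<in>F. P \<omega>" "p \<le> measure M F"
    by (auto simp: holds_with_prob_ge_def)
  then have "F \<subseteq> {\<omega> \<in> space M. P \<omega>}"
    using sets.sets_into_space by auto
  then have "measure M F \<le> measure M {\<omega> \<in> space M. P \<omega>}"
    using assms(2) by (rule finite_measure_mono)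
  with F show "p \<le> measure M {\<omega> \<in> space M. P \<omega>}" by simp
next
  assume "p \<le> measure M {\<omega> \<in> space M. P \<omega>}"
  then show "holds_with_prob_ge M P p"
    unfolding holds_with_prob_ge_def using assms(2)
    by (intro bexI[of _ "{\<omega> \<in> space M. P \<omega>}"]) auto
qed

end

theory Submission
  imports Defs
begin

text \<open>
  In place of a volumetric net, probabilistic estimates are taken over the integer points \<open>k\<close> with
  \<open>\<Sum>i. (k i)\<^sup>2 \<le> 2 d\<close> in dimension \<open>d\<close>, of which there are at most \<open>9 ^ d\<close>. A quadratic form that
  is at most \<open>a (\<Sum>i. (k i)\<^sup>2)\<close> in absolute value at those points is at least \<open>- 4 a (\<Sum>i. (z i)\<^sup>2)\<close>
  everywhere: a suitably scaled \<open>z\<close> can be rounded coordinate by coordinate, since a quadratic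
  function of one variable increases on average by its leading coefficient times the variance of
  the rounding.

  The union bound over this net gives, with the stated probability, that \<open>\<sigma>' j \<ge> \<sigma> j - \<delta> / 2\<close> and that
  \<open>E\<close> restricted to the singular subspaces of \<open>A\<close> has norm at most \<open>\<tau> = t r powr (1 / \<gamma>)\<close>. On this event
  split \<open>v' j\<close> along \<open>v 1, \<dots>, v r\<close>. The components with \<open>i < j\<close> are at most \<open>sin (v i, v' i)\<close>, as
  \<open>v' j\<close> is orthogonal to \<open>v' i\<close>. The component orthogonal to all \<open>v i\<close> is at most \<open>\<parallel>E\<parallel> / \<sigma>' j\<close>. For the
  components \<open>a\<close> of \<open>v' j\<close> and \<open>b\<close> of \<open>u' j\<close> with \<open>i > j\<close>, the singular equations give
  \<open>(\<sigma>' j - \<sigma> (j + 1)) (\<parallel>a\<parallel>\<^sup>2 + \<parallel>b\<parallel>\<^sup>2) \<le> (\<tau> + \<parallel>E\<parallel>\<^sup>2 / \<sigma>' j) (\<parallel>a\<parallel> + \<parallel>b\<parallel>)\<close>.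
\<close>

section \<open>Counting integer points in a ball\<close>

text \<open>A partial sum of a theta series. The value \<open>9/4\<close> matters because
  \<open>4 * (9/4)\<close> is the base \<open>9\<close> of the count of lattice points.\<close>

lemma sum_half_power_squares_le:
  "(\<Sum>k\<in>{-int N..int N}. (1/2::real) ^ ((nat \<bar>k\<bar>)\<^sup>2)) \<le> 9/4"
proof -
  \<comment> \<open>The slack \<open>(1/2) ^ (N + 2)\<close> carries the induction and is exact at
    \<open>N = 0\<close>: a new pair of end points adds at most \<open>(1/2) ^ N / 8\<close>, which
    is what the slack loses.\<close>
  have "(\<Sum>k\<in>{-int (Suc N)..int (Suc N)}. (1/2::real) ^ ((nat \<bar>k\<bar>)\<^sup>2)) \<le> 9/4 - (1/2) ^ (N + 2)" for N
  proof (induction N)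
    case 0
    have "{-1..1::int} = {-1,0,1}" by auto
    then show ?case by (simp add: power2_eq_square)
  next
    case (Suc N)
    let ?g = "\<lambda>k. (1/2::real) ^ ((nat \<bar>k\<bar>)\<^sup>2)"
    have eq: "{-int (Suc (Suc N))..int (Suc (Suc N))}
        = insert (- int (Suc (Suc N))) (insert (int (Suc (Suc N))) {-int (Suc N)..int (Suc N)})"
      by auto
    have n: "nat \<bar>- int (Suc (Suc N))\<bar> = N + 2" "nat \<bar>int (Suc (Suc N))\<bar> = N + 2" by auto
    have "sum ?g {-int (Suc (Suc N))..int (Suc (Suc N))}
        = 2 * (1/2) ^ ((N+2)\<^sup>2) + sum ?g {-int (Suc N)..int (Suc N)}"
      unfolding eq by (subst sum.insert; (subst sum.insert)?) (auto simp: n simp del: of_nat_Suc)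
    also have "(1/2::real) ^ ((N+2)\<^sup>2) \<le> (1/2) ^ (N + 4)"
      by (rule power_decreasing) (auto simp: power2_eq_square)
    also have "(1/2::real) ^ (N + 4) = (1/2) ^ N / 16" by (simp add: power_add power_one_over)
    moreover have "(1/2::real) ^ (N + 2) = (1/2) ^ N / 4" "(1/2::real) ^ (Suc N + 2) = (1/2) ^ N / 8"
      by (simp_all add: power_add power2_eq_square)
    ultimately show ?case using Suc.IH by linarith
  qed
  then have *: "(\<Sum>k\<in>{-int (Suc N)..int (Suc N)}. (1/2::real) ^ ((nat \<bar>k\<bar>)\<^sup>2)) \<le> 9/4" for N
    by (smt (verit) zero_less_power divide_pos_pos)
  show ?thesis
  proof (cases N)
    case 0
    then show ?thesis by simp
  next
    case (Suc n)
    then show ?thesis using * by blast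
  qed
qed

text \<open>Extensional functions keep the set finite. The squared radius \<open>2 * card I\<close>
  leaves room for the rounding of a point of squared norm \<open>card I / 6\<close>.\<close>

definition lattice_ball :: "'i set \<Rightarrow> ('i \<Rightarrow> int) set" where
  "lattice_ball I = {k \<in> I \<rightarrow>\<^sub>E UNIV. (\<Sum>i\<in>I. (k i)\<^sup>2) \<le> 2 * int (card I)}"

text \<open>An integer is at most its square in absolute value. The crude box suffices: it gives
  finiteness and a product domain over which weights factor.\<close>

lemma lattice_ball_subset:
  assumes "finite I"
  shows "lattice_ball I \<subseteq> I \<rightarrow>\<^sub>E {- int (2 * card I)..int (2 * card I)}"
proof
  fix k assume k: "k \<in> lattice_ball I"
  have "\<bar>k i\<bar> \<le> int (2 * card I)" if "i \<in> I" for i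
  proof -
    have "\<bar>k i\<bar> \<le> \<bar>k i\<bar> * \<bar>k i\<bar>"
      using mult_right_mono[of 1 "\<bar>k i\<bar>" "\<bar>k i\<bar>"] by (cases "k i = 0") auto
    also have "\<dots> = (k i)\<^sup>2" by (simp add: power2_eq_square)
    also have "\<dots> \<le> (\<Sum>i\<in>I. (k i)\<^sup>2)"
      using that assms by (intro member_le_sum) auto
    finally show ?thesis using k by (simp add: lattice_ball_def)
  qed
  then show "k \<in> I \<rightarrow>\<^sub>E {- int (2 * card I)..int (2 * card I)}"
    using k unfolding lattice_ball_def PiE_iff mem_Collect_eq atLeastAtMost_iff by (smt (verit))
qed

lemma finite_lattice_ball: "finite I \<Longrightarrow> finite (lattice_ball I)"
  by (rule finite_subset[OF lattice_ball_subset]) (simp_all add: finite_PiE)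

text \<open>Every point \<open>k\<close> of the ball has weight \<open>4 ^ card I / 2 ^ (\<Sum>i\<in>I. (k i)\<^sup>2) \<ge> 1\<close>, and these
  weights factor over the coordinates.\<close>
lemma card_lattice_ball_le:
  assumes "finite I"
  shows "card (lattice_ball I) \<le> 9 ^ card I"
proof -
  let ?B = "{- int (2 * card I)..int (2 * card I)}"
  let ?w = "\<lambda>k::int. 4 * (1/2::real) ^ ((nat \<bar>k\<bar>)\<^sup>2)"
  have "real (card (lattice_ball I)) = (\<Sum>k\<in>lattice_ball I. 1)" by simp
  also have "\<dots> \<le> (\<Sum>k\<in>lattice_ball I. \<Prod>i\<in>I. ?w (k i))"
  proof (rule sum_mono)
    fix k assume k: "k \<in> lattice_ball I"
    have "int (\<Sum>i\<in>I. (nat \<bar>k i\<bar>)\<^sup>2) \<le> int (2 * card I)"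
      using k by (simp add: lattice_ball_def)
    then have le: "(\<Sum>i\<in>I. (nat \<bar>k i\<bar>)\<^sup>2) \<le> 2 * card I" by linarith
    have "(\<Prod>i\<in>I. ?w (k i)) = 4 ^ card I * (1/2) ^ (\<Sum>i\<in>I. (nat \<bar>k i\<bar>)\<^sup>2)"
      by (simp add: prod.distrib power_sum)
    also have "\<dots> \<ge> 4 ^ card I * (1/2) ^ (2 * card I)"
      using le by (intro mult_left_mono power_decreasing) auto
    also have "4 ^ card I * (1/2::real) ^ (2 * card I) = 1"
      by (simp add: power_mult power_one_over power2_eq_square flip: power_mult_distrib)
    finally show "1 \<le> (\<Prod>i\<in>I. ?w (k i))" .
  qed
  also have "\<dots> \<le> (\<Sum>k\<in>I \<rightarrow>\<^sub>E ?B. \<Prod>i\<in>I. ?w (k i))"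
    using assms lattice_ball_subset by (intro sum_mono2 finite_PiE prod_nonneg) auto
  also have "\<dots> = (\<Prod>i\<in>I. \<Sum>k\<in>?B. ?w k)"
    using assms by (subst prod_sum_PiE) auto
  \<comment> \<open>Each coordinate contributes at most \<open>4 * (9/4) = 9\<close>.\<close>
  also have "\<dots> \<le> (\<Prod>i\<in>I. 9)"
    using sum_half_power_squares_le[of "2 * card I"]
    by (intro prod_mono conjI sum_nonneg) (auto simp flip: sum_distrib_left)
  finally have "real (card (lattice_ball I)) \<le> 9 ^ card I" by simp
  then show ?thesis by (metis of_nat_le_iff of_nat_numeral of_nat_power)
qed

section \<open>Rounding and quadratic forms\<close>

text \<open>One of the two neighbouring integers does no worse than the average over a random
  rounding. The linear term averages out, and a variance of at most \<open>1/4\<close> turns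
  \<open>2 * a\<close> into \<open>a / 2\<close>.\<close>

lemma quadratic_rounding:
  fixes x g l a :: real
  assumes "g \<le> 2 * a" "0 \<le> a"
  shows "\<exists>k::int. \<bar>of_int k - x\<bar> \<le> 1 \<and> g * (of_int k - x)\<^sup>2 + l * (of_int k - x) \<le> a / 2"
proof -
  define y where "y = x - of_int \<lfloor>x\<rfloor>"
  have y: "0 \<le> y" "y < 1" unfolding y_def by linarith+
  have yy: "y * (1 - y) \<le> 1/4"
    using zero_le_power2[of "y - 1/2"] by (simp add: power2_eq_square algebra_simps)
  \<comment> \<open>the average over a random rounding with mean \<open>x\<close> adds \<open>g\<close> times the variance \<open>y * (1 - y)\<close>\<close>
  have "(1 - y) * (g * (-y)\<^sup>2 + l * (-y)) + y * (g * (1-y)\<^sup>2 + l * (1-y)) = g * (y * (1 - y))"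
    by (simp add: power2_eq_square algebra_simps)
  also have "\<dots> \<le> 2 * a * (y * (1 - y))"
    using assms y by (intro mult_right_mono) auto
  also have "\<dots> \<le> 2 * a * (1/4)" using assms yy by (intro mult_left_mono) auto
  finally have av: "(1 - y) * (g * (-y)\<^sup>2 + l * (-y)) + y * (g * (1-y)\<^sup>2 + l * (1-y)) \<le> a / 2" by simp
  have "g * (-y)\<^sup>2 + l * (-y) \<le> a / 2 \<or> g * (1-y)\<^sup>2 + l * (1-y) \<le> a / 2"
  proof (rule ccontr)
    assume "\<not> ?thesis"
    \<comment> \<open>The weight \<open>1 - y\<close> is positive but \<open>y\<close> may vanish,
      so strictness is kept only in the first inequality.\<close>
    then have "a/2 < g * (-y)\<^sup>2 + l * (-y)" "a/2 \<le> g * (1-y)\<^sup>2 + l * (1-y)" by linarith+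
    then have "(1 - y) * (a/2) < (1 - y) * (g * (-y)\<^sup>2 + l * (-y))"
        "y * (a/2) \<le> y * (g * (1-y)\<^sup>2 + l * (1-y))"
      using y by (intro mult_strict_left_mono mult_left_mono; linarith)+
    moreover have "(1 - y) * (a/2) + y * (a/2) = a/2" by (simp add: field_simps)
    ultimately show False using av by linarith
  qed
  then show ?thesis
  proof
    assume "g * (-y)\<^sup>2 + l * (-y) \<le> a / 2"
    then show ?thesis using y by (intro exI[of _ "\<lfloor>x\<rfloor>"]) (auto simp: y_def)
  next
    assume "g * (1-y)\<^sup>2 + l * (1-y) \<le> a / 2"
    moreover have "of_int (\<lfloor>x\<rfloor> + 1) - x = 1 - y" by (simp add: y_def)
    ultimately show ?thesis using y by (intro exI[of _ "\<lfloor>x\<rfloor> + 1"]) (simp del: of_int_add)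
  qed
qed

text \<open>Each further coordinate costs at most \<open>a / 2\<close>, whatever its linear
  coefficient \<open>l\<close> has become; the leading coefficient \<open>g i\<close> does not
  depend on the values chosen before.\<close>

lemma greedy_rounding:
  fixes G :: "('i \<Rightarrow> real) \<Rightarrow> real" and g :: "'i \<Rightarrow> real" and a :: real
  assumes "finite J" and "0 \<le> a" and "\<And>i. i \<in> J \<Longrightarrow> g i \<le> 2 * a"
    and "\<And>z i. i \<in> J \<Longrightarrow> \<exists>l. \<forall>s. G (z(i := z i + s)) = G z + l * s + g i * s\<^sup>2"
  shows "\<exists>k::'i \<Rightarrow> int. (\<forall>i\<in>J. \<bar>of_int (k i) - z i\<bar> \<le> 1) \<and>
    G (\<lambda>i. if i \<in> J then of_int (k i) else z i) \<le> G z + card J * a / 2"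
  using assms(1,3,4)
proof (induction J)
  case empty
  then show ?case by simp
next
  case (insert j J)
  then obtain k :: "'i \<Rightarrow> int" where k: "\<forall>i\<in>J. \<bar>of_int (k i) - z i\<bar> \<le> 1"
    "G (\<lambda>i. if i \<in> J then of_int (k i) else z i) \<le> G z + card J * a / 2"
    using insert.IH insert.prems by blast
  let ?y = "\<lambda>i. if i \<in> J then of_int (k i) else z i"
  obtain l where l: "\<And>s. G (?y(j := ?y j + s)) = G ?y + l * s + g j * s\<^sup>2"
    using insert.prems(2)[of j ?y] by blast
  obtain n :: int where n: "\<bar>of_int n - z j\<bar> \<le> 1"
    "g j * (of_int n - z j)\<^sup>2 + l * (of_int n - z j) \<le> a / 2"
    using quadratic_rounding[of "g j" a "z j" l] insert.prems(1) assms(2) by blast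
  have "(\<lambda>i. if i \<in> insert j J then of_int ((k(j := n)) i) else z i) = ?y(j := ?y j + (of_int n - z j))"
    using insert.hyps by auto
  then have "G (\<lambda>i. if i \<in> insert j J then of_int ((k(j := n)) i) else z i)
     \<le> G z + card J * a / 2 + a / 2"
    using l[of "of_int n - z j"] n(2) k(2) by simp
  also have "\<dots> = G z + card (insert j J) * a / 2"
    using insert.hyps by (simp add: field_simps)
  finally show ?case
    using k(1) n(1) insert.hyps by (intro exI[of _ "k(j := n)"]) auto
qed

text \<open>With \<open>N\<close> the sum of squares, \<open>Q + a * N\<close> is nonnegative on the
  lattice ball, so by rounding it is at least \<open>- a * card I / 2\<close> at a multiple
  \<open>y\<close> of \<open>z\<close> with \<open>N y = card I / 6\<close>. Hence
  \<open>Q y \<ge> - 2 * a * card I / 3 = - 4 * a * N y\<close>, and homogeneity carries this over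
  to \<open>z\<close>.\<close>

lemma quadratic_form_lower_bound:
  fixes Q :: "('i \<Rightarrow> real) \<Rightarrow> real" and g :: "'i \<Rightarrow> real" and a :: real
  assumes fin: "finite I" and a: "0 \<le> a"
    and upd: "\<And>z i. i \<in> I \<Longrightarrow> \<exists>l. \<forall>s. Q (z(i := z i + s)) = Q z + l * s + g i * s\<^sup>2"
    and hom: "\<And>z c. Q (\<lambda>i. c * z i) = c\<^sup>2 * Q z"
    and cong: "\<And>z z'. (\<And>i. i \<in> I \<Longrightarrow> z i = z' i) \<Longrightarrow> Q z = Q z'"
    and lattice: "\<And>k. k \<in> lattice_ball I \<Longrightarrow> \<bar>Q (\<lambda>i. of_int (k i))\<bar> \<le> a * (\<Sum>i\<in>I. (of_int (k i))\<^sup>2)"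
  shows "Q z \<ge> - 4 * a * (\<Sum>i\<in>I. (z i)\<^sup>2)"
proof (cases "(\<Sum>i\<in>I. (z i)\<^sup>2) = 0")
  case True
  then have "\<And>i. i \<in> I \<Longrightarrow> z i = 0" using fin by (simp add: sum_nonneg_eq_0_iff)
  then have "Q z = Q (\<lambda>i. 0 * z i)" by (intro cong) auto
  also have "\<dots> = 0" by (subst hom) simp
  finally show ?thesis using True by simp
next
  case False
  define d where "d = real (card I)"
  define S where "S = (\<Sum>i\<in>I. (z i)\<^sup>2)"
  have S: "S > 0" using False by (simp add: S_def sum_nonneg order_less_le)
  have d: "d > 0" using False fin unfolding d_def by (cases "I = {}") (auto simp: card_gt_0_iff)
  have Q0: "Q (\<lambda>i. 0) = 0" using hom[of 0 z] by simp
  \<comment> \<open>The leading coefficient is the value of \<open>Q\<close> at a unit vector, which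
    lies in the ball. The linear part \<open>l\<close> there vanishes because \<open>Q\<close> is
    even.\<close>
  have g_le: "g i \<le> a" if i: "i \<in> I" for i
  proof -
    define k :: "'i \<Rightarrow> int" where "k = (\<lambda>i'. if i' \<in> I then (if i' = i then 1 else 0) else undefined)"
    have sum1: "(\<Sum>i'\<in>I. (k i')\<^sup>2) = 1"
      using fin i by (simp add: k_def if_distrib[of "\<lambda>x. x\<^sup>2"] sum.delta cong: if_cong)
    have card: "card I \<ge> 1" using i fin by (simp add: Suc_le_eq card_gt_0_iff) blast
    have "k \<in> lattice_ball I"
      using sum1 card by (auto simp: lattice_ball_def k_def)
    from lattice[OF this] have *: "\<bar>Q (\<lambda>i. of_int (k i))\<bar> \<le> a * real_of_int (\<Sum>i'\<in>I. (k i')\<^sup>2)" by simp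
    obtain l where l: "\<And>s. Q ((\<lambda>_. 0)(i := 0 + s)) = Q (\<lambda>_. 0) + l * s + g i * s\<^sup>2"
      using upd[OF i, of "\<lambda>_. 0"] by blast
    have "Q (\<lambda>i. of_int (k i)) = Q ((\<lambda>_. 0)(i := 0 + 1))"
      by (rule cong) (auto simp: k_def)
    also have "\<dots> = l + g i" using l[of 1] Q0 by simp
    finally have 1: "l + g i \<le> a" using * unfolding sum1 by simp
    have "l + g i = Q ((\<lambda>_. 0)(i := 0 + 1))" using l[of 1] Q0 by simp
    also have "\<dots> = Q (\<lambda>i'. (-1) * ((\<lambda>_. 0)(i := 0 + (-1))) i')"
      by (rule cong) auto
    also have "\<dots> = - l + g i" using l[of "-1"] Q0 hom[of "-1" "(\<lambda>_. 0)(i := 0 + (-1))"] by simp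
    finally show ?thesis using 1 by simp
  qed
  \<comment> \<open>the scale \<open>d / 6\<close> balances the rounding error against keeping the rounded point in the ball\<close>
  define c where "c = sqrt (d / (6 * S))"
  define y where "y = (\<lambda>i. c * z i)"
  have c2: "c\<^sup>2 = d / (6 * S)" using d S by (simp add: c_def)
  have y2: "(\<Sum>i\<in>I. (y i)\<^sup>2) = d / 6"
  proof -
    have "(\<Sum>i\<in>I. (y i)\<^sup>2) = c\<^sup>2 * S"
      by (simp add: y_def power_mult_distrib S_def sum_distrib_left)
    then show ?thesis using S by (simp add: c2)
  qed
  \<comment> \<open>The added term makes the form nonnegative at lattice points and raises the
    leading coefficients only to \<open>g i + a \<le> 2 * a\<close>, as the rounding
    requires.\<close>
  define G where "G = (\<lambda>z. Q z + a * (\<Sum>i\<in>I. (z i)\<^sup>2))"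
  have "\<exists>l. \<forall>s. G (z(i := z i + s)) = G z + l * s + (g i + a) * s\<^sup>2" if i: "i \<in> I" for z i
  proof -
    obtain l where l: "\<And>s. Q (z(i := z i + s)) = Q z + l * s + g i * s\<^sup>2"
      using upd[OF i] by blast
    have "(\<Sum>i'\<in>I. ((z(i := z i + s)) i')\<^sup>2) = (\<Sum>i'\<in>I. (z i')\<^sup>2) + 2 * z i * s + s\<^sup>2" for s
    proof -
      have "(\<Sum>i'\<in>I - {i}. ((z(i := z i + s)) i')\<^sup>2) = (\<Sum>i'\<in>I - {i}. (z i')\<^sup>2)"
        by (rule sum.cong) auto
      then show ?thesis
        unfolding sum.remove[OF fin i] by (simp add: power2_eq_square algebra_simps)
    qed
    then have "G (z(i := z i + s)) = G z + (l + 2 * a * z i) * s + (g i + a) * s\<^sup>2" for s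
      unfolding G_def l by (simp add: algebra_simps)
    then show ?thesis by blast
  qed
  from greedy_rounding[of I a "\<lambda>i. g i + a" G y, OF fin a _ this] g_le
  obtain k :: "'i \<Rightarrow> int" where k: "\<forall>i\<in>I. \<bar>of_int (k i) - y i\<bar> \<le> 1"
    "G (\<lambda>i. if i \<in> I then of_int (k i) else y i) \<le> G y + card I * a / 2"
    by fastforce
  define k' where "k' = restrict k I"
  \<comment> \<open>The constants \<open>7/2\<close> and \<open>7/5\<close> come from the square of
    \<open>5 * \<bar>y i\<bar> - 2\<close>; they give the total
    \<open>(7/12 + 7/5) * d = 119/60 * d\<close>, just below \<open>2 * d\<close>.\<close>
  have "real_of_int (\<Sum>i\<in>I. (k i)\<^sup>2) \<le> (\<Sum>i\<in>I. 7/2 * (y i)\<^sup>2 + 7/5)"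
    unfolding of_int_sum
  proof (rule sum_mono)
    fix i assume "i \<in> I"
    then have "\<bar>of_int (k i)\<bar> \<le> \<bar>y i\<bar> + 1" using k(1) by fastforce
    then have "\<bar>of_int (k i)\<bar>\<^sup>2 \<le> (\<bar>y i\<bar> + 1)\<^sup>2" by (intro power_mono) auto
    also have "\<dots> \<le> 7/2 * (y i)\<^sup>2 + 7/5"
      using zero_le_power2[of "5 * \<bar>y i\<bar> - 2"] by (simp add: power2_eq_square algebra_simps)
    finally show "of_int ((k i)\<^sup>2) \<le> 7/2 * (y i)\<^sup>2 + 7/5" by simp
  qed
  also have "\<dots> = 7/2 * (d / 6) + 7/5 * d"
    unfolding sum.distrib sum_distrib_left[symmetric] y2 by (simp add: d_def)
  also have "\<dots> \<le> real_of_int (2 * int (card I))" using d by (simp add: d_def)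
  finally have "(\<Sum>i\<in>I. (k i)\<^sup>2) \<le> 2 * int (card I)" by (simp only: of_int_le_iff)
  then have k': "k' \<in> lattice_ball I" by (simp add: lattice_ball_def k'_def)
  have "0 \<le> G (\<lambda>i. of_int (k' i))" using lattice[OF k'] by (simp add: G_def abs_le_iff)
  also have "\<dots> = G (\<lambda>i. if i \<in> I then of_int (k i) else y i)"
  proof -
    have "Q (\<lambda>i. of_int (k' i)) = Q (\<lambda>i. if i \<in> I then of_int (k i) else y i)"
      by (rule cong) (simp add: k'_def)
    then show ?thesis by (simp add: G_def k'_def)
  qed
  also have "\<dots> \<le> Q y + a * (d / 6) + d * a / 2"
    using k(2) by (simp add: G_def y2 d_def)
  finally have "0 \<le> Q y + 2 * a * d / 3" by simp
  also have "Q y = d / (6 * S) * Q z" unfolding y_def hom c2 ..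
  also have "d / (6 * S) * Q z + 2 * a * d / 3 = d / (6 * S) * (Q z + 4 * a * S)"
    using S by (simp add: divide_simps) (simp add: algebra_simps)
  finally have "0 \<le> Q z + 4 * a * S" using d S by (simp add: zero_le_mult_iff zero_le_divide_iff)
  then show ?thesis unfolding S_def by linarith
qed

section \<open>Union bound over the lattice ball\<close>

text \<open>At one lattice point the form is a multiple of
  \<open>x \<bullet> (E \<omega> *v y)\<close> with unit vectors, so concentration applies; a union
  bound and rounding extend the estimate to all \<open>z\<close>. Orthonormality is replaced by the
  condition \<open>norms\<close> so that the diagonal form (\<open>b = 1\<close>) and the bilinear
  form (\<open>b = 1/2\<close>) are both covered.\<close>

lemma concentrated_quadratic_form:
  fixes E :: "'a \<Rightarrow> real^'n^'m" and p :: "'i \<Rightarrow> real^'m" and w :: "'i \<Rightarrow> real^'n"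
  assumes "prob_space M" and E: "E \<in> borel_measurable M" and "0 \<le> C"
    and conc: "concentrated M E C c \<gamma>" and fin: "finite I" and b: "0 \<le> b" and s: "0 < s"
    and norms: "\<And>z. norm (\<Sum>i\<in>I. z i *\<^sub>R p i) * norm (\<Sum>i\<in>I. z i *\<^sub>R w i) \<le> b * (\<Sum>i\<in>I. (z i)\<^sup>2)"
  shows "\<exists>F\<in>sets M. 1 - C * 9 ^ card I * exp (- c * s powr \<gamma>) \<le> measure M F \<and>
    (\<forall>\<omega>\<in>F. \<forall>z. - 4 * (b * s) * (\<Sum>i\<in>I. (z i)\<^sup>2)
       \<le> (\<Sum>i\<in>I. z i *\<^sub>R p i) \<bullet> (E \<omega> *v (\<Sum>i\<in>I. z i *\<^sub>R w i)))"
proof -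
  interpret prob_space M by fact
  define P where "P = (\<lambda>z. \<Sum>i\<in>I. z i *\<^sub>R p i)"
  define W where "W = (\<lambda>z. \<Sum>i\<in>I. z i *\<^sub>R w i)"
  define Q where "Q = (\<lambda>\<omega> z. P z \<bullet> (E \<omega> *v W z))"
  define R where "R = (\<lambda>k::'i \<Rightarrow> int. (\<lambda>i. real_of_int (k i)))"
  define N where "N = (\<lambda>z::'i \<Rightarrow> real. \<Sum>i\<in>I. (z i)\<^sup>2)"
  have "continuous_on UNIV (\<lambda>B::real^'n^'m. x \<bullet> (B *v y))" for x y
    unfolding matrix_vector_mult_def by (intro continuous_intros)
  then have [measurable]: "(\<lambda>\<omega>. x \<bullet> (E \<omega> *v y)) \<in> borel_measurable M" for x y
    using E by (intro measurable_compose[OF E]) (auto intro: borel_measurable_continuous_onI)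
  define B where "B = (\<lambda>k. {\<omega>\<in>space M. b * s * N (R k) < \<bar>Q \<omega> (R k)\<bar>})"
  have B_sets: "B k \<in> sets M" for k unfolding B_def Q_def by measurable
  have B_le: "prob (B k) \<le> C * exp (- c * s powr \<gamma>)" for k
  \<comment> \<open>A zero vector cannot be normalised, but then the form vanishes and the strict
    inequality makes the bad event empty.\<close>
  proof (cases "P (R k) = 0 \<or> W (R k) = 0")
    case True
    moreover have "0 \<le> b * s * N (R k)" using b s by (auto simp: N_def sum_nonneg)
    ultimately have "B k = {}" by (auto simp: B_def Q_def)
    then show ?thesis using \<open>0 \<le> C\<close> by simp
  next
    case False
    let ?x = "P (R k) /\<^sub>R norm (P (R k))" and ?y = "W (R k) /\<^sub>R norm (W (R k))"
    have "B k \<subseteq> {\<omega>\<in>space M. s < \<bar>?x \<bullet> (E \<omega> *v ?y)\<bar>}"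
    proof
      fix \<omega> assume \<omega>: "\<omega> \<in> B k"
      have "s * (norm (P (R k)) * norm (W (R k))) \<le> s * (b * N (R k))"
        using norms[of "R k"] s by (intro mult_left_mono) (auto simp: P_def W_def N_def)
      also have "\<dots> < \<bar>Q \<omega> (R k)\<bar>" using \<omega> by (simp add: B_def mult_ac)
      finally have "s < \<bar>Q \<omega> (R k)\<bar> / (norm (P (R k)) * norm (W (R k)))"
        using False by (simp add: pos_less_divide_eq)
      also have "\<dots> = \<bar>?x \<bullet> (E \<omega> *v ?y)\<bar>"
        by (simp add: Q_def matrix_vector_mult_scaleR abs_mult divide_inverse mult_ac)
      finally show "\<omega> \<in> {\<omega>\<in>space M. s < \<bar>?x \<bullet> (E \<omega> *v ?y)\<bar>}" using \<omega> by (simp add: B_def)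
    qed
    then have "prob (B k) \<le> prob {\<omega>\<in>space M. s < \<bar>?x \<bullet> (E \<omega> *v ?y)\<bar>}"
      by (rule finite_measure_mono) measurable
    also have "\<dots> \<le> C * exp (- c * s powr \<gamma>)"
    proof -
      have "norm ?x = 1" "norm ?y = 1" using False by auto
      then show ?thesis using conc s unfolding concentrated_def by blast
    qed
    finally show ?thesis .
  qed
  \<comment> \<open>The event excludes only finitely many bad sets, so it is measurable although the
    conclusion concerns all real \<open>z\<close>.\<close>
  define F where "F = space M - (\<Union>k\<in>lattice_ball I. B k)"
  have U: "(\<Union>k\<in>lattice_ball I. B k) \<in> sets M"
    using B_sets finite_lattice_ball[OF fin] by (intro sets.finite_UN) auto
  have "prob (\<Union>k\<in>lattice_ball I. B k) \<le> (\<Sum>k\<in>lattice_ball I. prob (B k))"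
    using B_sets finite_lattice_ball[OF fin] by (intro finite_measure_subadditive_finite) auto
  also have "\<dots> \<le> of_nat (card (lattice_ball I)) * (C * exp (- c * s powr \<gamma>))"
    by (rule sum_bounded_above) (rule B_le)
  also have "\<dots> \<le> of_nat (9 ^ card I) * (C * exp (- c * s powr \<gamma>))"
    using \<open>0 \<le> C\<close> card_lattice_ball_le[OF fin] by (intro mult_right_mono of_nat_mono) auto
  finally have "1 - C * 9 ^ card I * exp (- c * s powr \<gamma>) \<le> measure M F"
    unfolding F_def prob_compl[OF U] by (simp add: mult_ac)
  moreover have "- 4 * (b * s) * N z \<le> Q \<omega> z" if \<omega>: "\<omega> \<in> F" for \<omega> z
    unfolding N_def
  proof (rule quadratic_form_lower_bound[where g = "\<lambda>i. p i \<bullet> (E \<omega> *v w i)"])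
    show "finite I" "0 \<le> b * s" using fin b s by auto
    show "\<exists>l. \<forall>s. Q \<omega> (z(i := z i + s)) = Q \<omega> z + l * s + (p i \<bullet> (E \<omega> *v w i)) * s\<^sup>2"
      if i: "i \<in> I" for z i
    proof -
      have *: "(\<Sum>i'\<in>I. (z(i := z i + s)) i' *\<^sub>R f i') = (\<Sum>i'\<in>I. z i' *\<^sub>R f i') + s *\<^sub>R f i"
        for s and f :: "'i \<Rightarrow> 'v::real_vector"
      proof -
        have "(\<Sum>i'\<in>I - {i}. (z(i := z i + s)) i' *\<^sub>R f i') = (\<Sum>i'\<in>I - {i}. z i' *\<^sub>R f i')"
          by (rule sum.cong) auto
        then show ?thesis unfolding sum.remove[OF fin i] by (simp add: algebra_simps)
      qed
      have "Q \<omega> (z(i := z i + s)) = Q \<omega> z + (P z \<bullet> (E \<omega> *v w i) + p i \<bullet> (E \<omega> *v W z)) * s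
        + (p i \<bullet> (E \<omega> *v w i)) * s\<^sup>2" for s
        unfolding Q_def P_def W_def *
        by (simp add: matrix_vector_right_distrib matrix_vector_mult_scaleR inner_add_left inner_add_right
            power2_eq_square algebra_simps)
      then show ?thesis by blast
    qed
    show "Q \<omega> (\<lambda>i. a * z i) = a\<^sup>2 * Q \<omega> z" for a z
    proof -
      have "P (\<lambda>i. a * z i) = a *\<^sub>R P z" "W (\<lambda>i. a * z i) = a *\<^sub>R W z"
        unfolding P_def W_def scaleR_sum_right by simp_all
      then show ?thesis by (simp add: Q_def matrix_vector_mult_scaleR power2_eq_square)
    qed
    show "Q \<omega> z = Q \<omega> z'" if "\<And>i. i \<in> I \<Longrightarrow> z i = z' i" for z z'
      using that by (simp add: Q_def P_def W_def)
    show "\<bar>Q \<omega> (\<lambda>i. real_of_int (k i))\<bar> \<le> b * s * (\<Sum>i\<in>I. (real_of_int (k i))\<^sup>2)"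
      if "k \<in> lattice_ball I" for k
    proof -
      have "\<omega> \<in> space M" "\<omega> \<notin> B k" using \<omega> that by (auto simp: F_def)
      then show ?thesis by (auto simp: B_def R_def N_def)
    qed
  qed
  ultimately show ?thesis
    using U by (intro bexI[of _ F]) (auto simp: F_def Q_def P_def W_def N_def)
qed

section \<open>Orthonormal families and dimension counts\<close>

lemma orthonormal_family_subset: "orthonormal_family I x \<Longrightarrow> J \<subseteq> I \<Longrightarrow> orthonormal_family J x"
  unfolding orthonormal_family_def by blast

lemma orthonormal_inner_sum:
  assumes "orthonormal_family I x" "finite I" "i \<in> I"
  shows "x i \<bullet> (\<Sum>k\<in>I. a k *\<^sub>R x k) = a i"
proof -
  have "x i \<bullet> (\<Sum>k\<in>I. a k *\<^sub>R x k) = (\<Sum>k\<in>I. if i = k then a k else 0)"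
    unfolding inner_sum_right using assms by (intro sum.cong) (auto simp: orthonormal_family_def)
  then show ?thesis using assms by simp
qed

lemma orthonormal_norm_sum:
  assumes "orthonormal_family I x" "finite I"
  shows "(norm (\<Sum>k\<in>I. a k *\<^sub>R x k))\<^sup>2 = (\<Sum>k\<in>I. (a k)\<^sup>2)"
proof -
  have "(\<Sum>k\<in>I. a k *\<^sub>R x k) \<bullet> (\<Sum>k\<in>I. a k *\<^sub>R x k) = (\<Sum>i\<in>I. a i * (x i \<bullet> (\<Sum>k\<in>I. a k *\<^sub>R x k)))"
    by (subst inner_sum_left) simp
  then show ?thesis
    using assms by (simp add: power2_norm_eq_inner orthonormal_inner_sum flip: power2_eq_square)
qed

text \<open>Pythagoras for the projection onto the span of the family.\<close>

lemma orthonormal_decomp: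
  assumes "orthonormal_family I x" "finite I"
  shows "(norm y)\<^sup>2 = (\<Sum>k\<in>I. (x k \<bullet> y)\<^sup>2) + (norm (y - (\<Sum>k\<in>I. (x k \<bullet> y) *\<^sub>R x k)))\<^sup>2"
proof -
  let ?p = "\<Sum>k\<in>I. (x k \<bullet> y) *\<^sub>R x k"
  have "y \<bullet> ?p = (\<Sum>k\<in>I. (x k \<bullet> y)\<^sup>2)"
    by (simp add: inner_sum_right power2_eq_square inner_commute)
  moreover have "?p \<bullet> ?p = (\<Sum>k\<in>I. (x k \<bullet> y)\<^sup>2)"
    using orthonormal_norm_sum[OF assms] by (simp add: power2_norm_eq_inner)
  ultimately show ?thesis
    by (simp add: power2_norm_eq_inner inner_diff_left inner_diff_right inner_commute)
qed

lemma orthonormal_bessel: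
  assumes "orthonormal_family I x" "finite I"
  shows "(\<Sum>k\<in>I. (x k \<bullet> y)\<^sup>2) \<le> (norm y)\<^sup>2"
  using orthonormal_decomp[OF assms, of y] by simp

text \<open>Both sides are linear in \<open>y\<close> and agree at every \<open>x i\<close>.\<close>

lemma orthonormal_span:
  assumes "orthonormal_family I x" "finite I" "y \<in> span (x ` I)"
  shows "y = (\<Sum>k\<in>I. (x k \<bullet> y) *\<^sub>R x k)"
  using assms(3)
proof (induction rule: span_induct_alt)
  case base
  then show ?case by simp
next
  case (step c z y)
  then obtain i where i: "i \<in> I" "z = x i" by auto
  have "(\<Sum>k\<in>I. (x k \<bullet> z) *\<^sub>R x k) = (\<Sum>k\<in>I. if k = i then z else 0)"
    using i assms(1) by (intro sum.cong) (auto simp: orthonormal_family_def)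
  then have "(\<Sum>k\<in>I. (x k \<bullet> z) *\<^sub>R x k) = z" using i assms(2) by simp
  moreover have "(\<Sum>k\<in>I. (x k \<bullet> (c *\<^sub>R z + y)) *\<^sub>R x k)
     = c *\<^sub>R (\<Sum>k\<in>I. (x k \<bullet> z) *\<^sub>R x k) + (\<Sum>k\<in>I. (x k \<bullet> y) *\<^sub>R x k)"
    by (simp add: inner_add_right scaleR_add_left sum.distrib scaleR_sum_right)
  ultimately show ?case using step.IH by simp
qed

lemma orthonormal_inj_independent:
  assumes "orthonormal_family I x"
  shows "inj_on x I" "independent (x ` I)"
proof -
  show "inj_on x I"
    using assms unfolding orthonormal_family_def inj_on_def by (metis zero_neq_one)
  show "independent (x ` I)"
  proof (rule pairwise_orthogonal_independent)
    show "pairwise orthogonal (x ` I)"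
      using assms unfolding orthonormal_family_def pairwise_def orthogonal_def by auto
    show "0 \<notin> x ` I" using assms unfolding orthonormal_family_def by force
  qed
qed

lemma orthonormal_dim:
  fixes x :: "nat \<Rightarrow> 'b::euclidean_space"
  assumes "orthonormal_family I x"
  shows "dim (x ` I) = card I"
  using orthonormal_inj_independent[OF assms] by (simp add: dim_eq_card_independent card_image)

lemma orthonormal_basis_expansion:
  fixes x :: "nat \<Rightarrow> 'b::euclidean_space"
  assumes "orthonormal_family I x" "finite I" "card I = DIM('b)"
  shows "y = (\<Sum>k\<in>I. (x k \<bullet> y) *\<^sub>R x k)"
proof (rule orthonormal_span[OF assms(1,2)])
  have "dim (x ` I) = DIM('b)" using orthonormal_dim[OF assms(1)] assms(3) by simp
  then show "y \<in> span (x ` I)" by (simp add: dim_eq_full)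
qed

text \<open>Dimension count: at most \<open>j - 1\<close> orthogonality conditions cannot exclude
  every nonzero vector of a \<open>j\<close>-dimensional space. This supplies the test vector of the
  min-max argument.\<close>

lemma exists_orthogonal_in_span:
  fixes v w :: "nat \<Rightarrow> 'b::euclidean_space"
  assumes "orthonormal_family {1..j} v" "1 \<le> j"
  shows "\<exists>z. (\<Sum>i\<in>{1..j}. (z i)\<^sup>2) > 0 \<and> (\<forall>k\<in>{1..<j}. w k \<bullet> (\<Sum>i\<in>{1..j}. z i *\<^sub>R v i) = 0)"
proof -
  let ?S = "span (v ` {1..j})" and ?W = "span (w ` {1..<j})"
  define T where "T = {y \<in> UNIV. \<forall>x\<in>?W. orthogonal x y}"
  have T: "subspace T" unfolding T_def by (auto simp: subspace_def orthogonal_clauses)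
  have "dim ?W \<le> card (w ` {1..<j})" by (simp add: dim_le_card')
  also have "\<dots> \<le> j - 1" using card_image_le[of "{1..<j}" w] by simp
  finally have "dim ?W < j" using assms by simp
  moreover have "dim T + dim ?W = DIM('b)"
    using dim_subspace_orthogonal_to_vectors[of ?W UNIV] unfolding T_def by simp
  moreover have "dim {x + y |x y. x \<in> ?S \<and> y \<in> T} + dim (?S \<inter> T) = dim ?S + dim T"
    using dim_sums_Int[OF _ T] by auto
  moreover have "dim {x + y |x y. x \<in> ?S \<and> y \<in> T} \<le> DIM('b)" by (rule dim_subset_UNIV)
  moreover have "dim ?S = j" using orthonormal_dim[OF assms(1)] by simp
  ultimately have "dim (?S \<inter> T) > 0" by linarith
  then have "\<not> ?S \<inter> T \<subseteq> {0}" by (metis dim_eq_0 less_numeral_extra(3))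
  then obtain x where x: "x \<in> ?S" "x \<in> T" "x \<noteq> 0" by blast
  have eq: "x = (\<Sum>i\<in>{1..j}. (v i \<bullet> x) *\<^sub>R v i)"
    using orthonormal_span[OF assms(1) _ x(1)] by simp
  have "(\<Sum>i\<in>{1..j}. (v i \<bullet> x)\<^sup>2) = (norm x)\<^sup>2"
    using orthonormal_norm_sum[OF assms(1), of "\<lambda>i. v i \<bullet> x"] eq by simp
  then have "(\<Sum>i\<in>{1..j}. (v i \<bullet> x)\<^sup>2) > 0" using x by simp
  moreover have "w k \<bullet> x = 0" if "k \<in> {1..<j}" for k
    using x(2) that by (auto simp: T_def orthogonal_def span_base)
  ultimately show ?thesis using eq by (intro exI[of _ "\<lambda>i. v i \<bullet> x"]) auto
qed

section \<open>Singular systems: expansion, rank and min-max bound\<close>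

lemma inner_matrix_transpose:
  fixes A :: "real^'n^'m"
  shows "(transpose A *v y) \<bullet> x = y \<bullet> (A *v x)"
  by (simp add: transpose_matrix_vector dot_lmul_matrix)

lemma singular_system_transpose:
  "singular_system A \<sigma> u v \<Longrightarrow> singular_system (transpose A) \<sigma> v u"
  unfolding singular_system_def by (auto simp: min.commute)

text \<open>Only the family on the side of smaller dimension is sure to be a basis: \<open>x\<close>
  is expanded in \<open>v\<close> if \<open>CARD('n) \<le> CARD('m)\<close>, and otherwise
  \<open>y\<close> in \<open>u\<close>.\<close>

lemma singular_system_expansion:
  fixes A :: "real^'n^'m"
  assumes "singular_system A \<sigma> u v"
  shows "y \<bullet> (A *v x) = (\<Sum>i\<in>{1..min CARD('m) CARD('n)}. \<sigma> i * (v i \<bullet> x) * (u i \<bullet> y))"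
proof -
  let ?I = "{1..min CARD('m) CARD('n)}"
  have ss: "orthonormal_family ?I u" "orthonormal_family ?I v"
    "\<And>i. i \<in> ?I \<Longrightarrow> A *v v i = \<sigma> i *\<^sub>R u i" "\<And>i. i \<in> ?I \<Longrightarrow> transpose A *v u i = \<sigma> i *\<^sub>R v i"
    using assms unfolding singular_system_def by auto
  show ?thesis
  proof (cases "CARD('n) \<le> CARD('m)")
    case True
    then have "x = (\<Sum>i\<in>?I. (v i \<bullet> x) *\<^sub>R v i)"
      by (intro orthonormal_basis_expansion[OF ss(2)]) auto
    then have "y \<bullet> (A *v x) = y \<bullet> (A *v (\<Sum>i\<in>?I. (v i \<bullet> x) *\<^sub>R v i))" by simp
    also have "\<dots> = (\<Sum>i\<in>?I. (v i \<bullet> x) * (y \<bullet> (A *v v i)))"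
      by (simp add: linear_sum[OF matrix_vector_mul_linear] matrix_vector_mult_scaleR inner_sum_right)
    also have "\<dots> = (\<Sum>i\<in>?I. \<sigma> i * (v i \<bullet> x) * (u i \<bullet> y))"
      by (rule sum.cong) (simp_all add: ss inner_commute)
    finally show ?thesis .
  next
    case False
    then have "y = (\<Sum>i\<in>?I. (u i \<bullet> y) *\<^sub>R u i)"
      by (intro orthonormal_basis_expansion[OF ss(1)]) auto
    then have "y \<bullet> (A *v x) = (\<Sum>i\<in>?I. (u i \<bullet> y) *\<^sub>R u i) \<bullet> (A *v x)" by simp
    also have "\<dots> = (\<Sum>i\<in>?I. (u i \<bullet> y) * ((transpose A *v u i) \<bullet> x))"
      by (simp only: inner_sum_left inner_scaleR_left inner_matrix_transpose)
    also have "\<dots> = (\<Sum>i\<in>?I. \<sigma> i * (v i \<bullet> x) * (u i \<bullet> y))"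
      by (rule sum.cong) (simp_all only: ss inner_scaleR_left mult_ac)
    finally show ?thesis .
  qed
qed

text \<open>Left vectors with positive singular value lie in the range, which bounds the rank below.
  If \<open>\<sigma> i = 0\<close>, the expansion stops before \<open>i\<close> and the range lies
  in a span of \<open>i - 1\<close> vectors.\<close>

lemma singular_system_rank:
  fixes A :: "real^'n^'m"
  assumes ss: "singular_system A \<sigma> u v" and i: "1 \<le> i"
  shows "\<sigma> i > 0 \<longleftrightarrow> i \<le> rank A"
proof -
  let ?m = "min CARD('m) CARD('n)"
  have s: "\<forall>i\<ge>1. 0 \<le> \<sigma> i" "\<forall>i\<ge>1. \<forall>k\<ge>i. \<sigma> k \<le> \<sigma> i" "\<forall>i>?m. \<sigma> i = 0"
    "orthonormal_family {1..?m} u" "\<forall>i\<in>{1..?m}. A *v v i = \<sigma> i *\<^sub>R u i"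
    using ss unfolding singular_system_def by auto
  show ?thesis
  proof
    assume pos: "\<sigma> i > 0"
    then have im: "i \<le> ?m" using s(3) by (metis less_irrefl not_le)
    have "u k \<in> range ((*v) A)" if "k \<in> {1..i}" for k
    proof -
      have "\<sigma> k > 0" using s(2) pos that by force
      then have "u k = A *v (v k /\<^sub>R \<sigma> k)"
        using s(5) that im by (simp add: matrix_vector_mult_scaleR)
      then show ?thesis by blast
    qed
    then have "dim (u ` {1..i}) \<le> dim (range ((*v) A))"
      by (intro dim_subset) auto
    moreover have "dim (u ` {1..i}) = i"
      using orthonormal_dim[OF orthonormal_family_subset[OF s(4), of "{1..i}"]] im by simp
    ultimately show "i \<le> rank A" by (simp add: rank_dim_range)
  next
    assume le: "i \<le> rank A"
    show "\<sigma> i > 0"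
    proof (rule ccontr)
      assume "\<not> \<sigma> i > 0"
      then have 0: "\<sigma> k = 0" if "k \<ge> i" for k
        using s(1,2) i that by (smt (verit) le_trans)
      have "range ((*v) A) \<subseteq> span (u ` {1..<i})"
      proof clarify
        fix x
        let ?z = "\<Sum>k\<in>{1..?m}. (\<sigma> k * (v k \<bullet> x)) *\<^sub>R u k"
        have "y \<bullet> (A *v x) = y \<bullet> ?z" for y
          by (simp add: singular_system_expansion[OF ss] inner_sum_right inner_commute)
        then have "A *v x = ?z" by (metis vector_eq_ldot)
        also have "\<dots> \<in> span (u ` {1..<i})"
        proof (rule span_sum)
          fix k assume "k \<in> {1..?m}"
          then show "(\<sigma> k * (v k \<bullet> x)) *\<^sub>R u k \<in> span (u ` {1..<i})"
            using 0[of k] by (cases "k < i") (auto simp: span_zero intro!: span_scale intro: span_base)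
        qed
        finally show "A *v x \<in> span (u ` {1..<i})" .
      qed
      then have "rank A \<le> dim (span (u ` {1..<i}))"
        unfolding rank_dim_range by (rule dim_subset)
      also have "\<dots> \<le> card (u ` {1..<i})" by (simp add: dim_le_card')
      also have "\<dots> \<le> i - 1" using card_image_le[of "{1..<i}" u] by simp
      finally show False using le i by simp
    qed
  qed
qed

text \<open>Testing the min-max characterisation of \<open>\<sigma>' j\<close> with the same coefficients on both sides turns
  a bilinear estimate into one for a quadratic form, which needs a net in dimension \<open>j\<close> only.\<close>
lemma singular_value_lower_bound:
  fixes B :: "real^'n^'m"
  assumes ss: "singular_system B \<sigma>' u' v'" and j: "1 \<le> j"
    and u: "orthonormal_family {1..j} u" and v: "orthonormal_family {1..j} v"
    and form: "\<And>z. \<kappa> * (\<Sum>i\<in>{1..j}. (z i)\<^sup>2)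
      \<le> (\<Sum>i\<in>{1..j}. z i *\<^sub>R u i) \<bullet> (B *v (\<Sum>i\<in>{1..j}. z i *\<^sub>R v i))"
  shows "\<kappa> \<le> \<sigma>' j"
proof -
  let ?I = "{1..min CARD('m) CARD('n)}"
  \<comment> \<open>Only \<open>x\<close> is made orthogonal to the first \<open>j - 1\<close>
    vectors \<open>v' k\<close>; one vanishing factor already removes those products from the
    expansion.\<close>
  obtain z where z: "(\<Sum>i\<in>{1..j}. (z i)\<^sup>2) > 0"
    "\<And>k. k \<in> {1..<j} \<Longrightarrow> v' k \<bullet> (\<Sum>i\<in>{1..j}. z i *\<^sub>R v i) = 0"
    using exists_orthogonal_in_span[OF v j, of v'] by blast
  define x where "x = (\<Sum>i\<in>{1..j}. z i *\<^sub>R v i)"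
  define y where "y = (\<Sum>i\<in>{1..j}. z i *\<^sub>R u i)"
  define S where "S = (\<Sum>i\<in>{1..j}. (z i)\<^sup>2)"
  have x2: "(norm x)\<^sup>2 = S" and y2: "(norm y)\<^sup>2 = S"
    unfolding x_def y_def S_def using orthonormal_norm_sum[OF u] orthonormal_norm_sum[OF v] by auto
  have s: "orthonormal_family ?I u'" "orthonormal_family ?I v'" "\<And>i. i \<ge> j \<Longrightarrow> \<sigma>' i \<le> \<sigma>' j"
    "\<And>i. i \<ge> 1 \<Longrightarrow> 0 \<le> \<sigma>' i"
    using ss j unfolding singular_system_def by auto
  have "\<kappa> * S \<le> y \<bullet> (B *v x)" using form unfolding x_def y_def S_def by blast
  also have "\<dots> = (\<Sum>i\<in>?I. \<sigma>' i * (v' i \<bullet> x) * (u' i \<bullet> y))"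
    by (rule singular_system_expansion[OF ss])
  also have "\<dots> \<le> (\<Sum>i\<in>?I. \<sigma>' j * (((v' i \<bullet> x)\<^sup>2 + (u' i \<bullet> y)\<^sup>2) / 2))"
  proof (rule sum_mono)
    fix i assume i: "i \<in> ?I"
    show "\<sigma>' i * (v' i \<bullet> x) * (u' i \<bullet> y) \<le> \<sigma>' j * (((v' i \<bullet> x)\<^sup>2 + (u' i \<bullet> y)\<^sup>2) / 2)"
    proof (cases "i < j")
      case True
      then have "v' i \<bullet> x = 0" using z(2)[of i] i by (simp add: x_def)
      then show ?thesis using s(4)[OF j] by simp
    next
      case False
      have "(v' i \<bullet> x) * (u' i \<bullet> y) \<le> ((v' i \<bullet> x)\<^sup>2 + (u' i \<bullet> y)\<^sup>2) / 2"
        using sum_squares_bound[of "v' i \<bullet> x" "u' i \<bullet> y"] by simp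
      then have "\<sigma>' i * ((v' i \<bullet> x) * (u' i \<bullet> y)) \<le> \<sigma>' i * (((v' i \<bullet> x)\<^sup>2 + (u' i \<bullet> y)\<^sup>2) / 2)"
        using s(4) i by (intro mult_left_mono) auto
      also have "\<dots> \<le> \<sigma>' j * (((v' i \<bullet> x)\<^sup>2 + (u' i \<bullet> y)\<^sup>2) / 2)"
        using s(3) False by (intro mult_right_mono) auto
      finally show ?thesis by (simp add: mult_ac)
    qed
  qed
  also have "\<dots> = \<sigma>' j * (((\<Sum>i\<in>?I. (v' i \<bullet> x)\<^sup>2) + (\<Sum>i\<in>?I. (u' i \<bullet> y)\<^sup>2)) / 2)"
    by (simp only: sum.distrib flip: sum_distrib_left sum_divide_distrib)
  also have "\<dots> \<le> \<sigma>' j * ((S + S) / 2)"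
    using orthonormal_bessel[OF s(1), of y] orthonormal_bessel[OF s(2), of x] s(4)[OF j] x2 y2
    by (intro mult_left_mono divide_right_mono add_mono) auto
  finally show ?thesis using z(1) unfolding S_def[symmetric] by simp
qed

section \<open>The noise restricted to the singular subspaces\<close>

text \<open>A bilinear form on two \<open>r\<close>-dimensional spaces is a quadratic form in
  \<open>2 * r\<close> variables, indexed by a disjoint sum; hence the factor
  \<open>9 ^ (2 * r)\<close>. The vectors \<open>p\<close> and \<open>w\<close> vanish on each
  other's half of the indices.\<close>

lemma concentrated_bilinear_form:
  fixes E :: "'a \<Rightarrow> real^'n^'m"
  assumes "prob_space M" and "E \<in> borel_measurable M" and "0 \<le> C"
    and "concentrated M E C c \<gamma>" and s: "0 < s"
    and u: "orthonormal_family {1..r} u" and v: "orthonormal_family {1..r} v"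
  shows "\<exists>F\<in>sets M. 1 - C * 9 ^ (2 * r) * exp (- c * s powr \<gamma>) \<le> measure M F \<and>
    (\<forall>\<omega>\<in>F. \<forall>x\<in>span (v ` {1..r}). \<forall>y\<in>span (u ` {1..r}).
       \<bar>y \<bullet> (E \<omega> *v x)\<bar> \<le> 4 * s * norm x * norm y)"
proof -
  let ?I = "{1..r} <+> {1..r}"
  define p where "p = case_sum u (\<lambda>_::nat. 0)"
  define w where "w = case_sum (\<lambda>_::nat. 0) v"
  have P: "(\<Sum>i\<in>?I. z i *\<^sub>R p i) = (\<Sum>i\<in>{1..r}. z (Inl i) *\<^sub>R u i)" for z
    by (simp add: sum.Plus p_def)
  have W: "(\<Sum>i\<in>?I. z i *\<^sub>R w i) = (\<Sum>i\<in>{1..r}. z (Inr i) *\<^sub>R v i)" for z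
    by (simp add: sum.Plus w_def)
  have N: "(\<Sum>i\<in>?I. (z i)\<^sup>2) = (norm (\<Sum>i\<in>{1..r}. z (Inl i) *\<^sub>R u i))\<^sup>2
      + (norm (\<Sum>i\<in>{1..r}. z (Inr i) *\<^sub>R v i))\<^sup>2" for z
    using orthonormal_norm_sum[OF u] orthonormal_norm_sum[OF v] by (simp add: sum.Plus)
  have "norm (\<Sum>i\<in>?I. z i *\<^sub>R p i) * norm (\<Sum>i\<in>?I. z i *\<^sub>R w i) \<le> 1/2 * (\<Sum>i\<in>?I. (z i)\<^sup>2)" for z
    unfolding P W N using sum_squares_bound[of "norm (\<Sum>i\<in>{1..r}. z (Inl i) *\<^sub>R u i)"
      "norm (\<Sum>i\<in>{1..r}. z (Inr i) *\<^sub>R v i)"] by simp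
  from concentrated_quadratic_form[OF assms(1-4) _ _ s this]
  obtain F where F: "F \<in> sets M" "1 - C * 9 ^ card ?I * exp (- c * s powr \<gamma>) \<le> measure M F"
    and form: "\<And>\<omega> z. \<omega> \<in> F \<Longrightarrow> - 4 * (1/2 * s) * (\<Sum>i\<in>?I. (z i)\<^sup>2)
       \<le> (\<Sum>i\<in>?I. z i *\<^sub>R p i) \<bullet> (E \<omega> *v (\<Sum>i\<in>?I. z i *\<^sub>R w i))"
    by auto
  have low: "- 2 * s * ((norm x)\<^sup>2 + (norm y)\<^sup>2) \<le> y \<bullet> (E \<omega> *v x)"
    if \<omega>: "\<omega> \<in> F" and x: "x \<in> span (v ` {1..r})" and y: "y \<in> span (u ` {1..r})" for \<omega> x y
  proof -
    let ?z = "case_sum (\<lambda>i. u i \<bullet> y) (\<lambda>i. v i \<bullet> x)"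
    have "x = (\<Sum>i\<in>{1..r}. (v i \<bullet> x) *\<^sub>R v i)" "y = (\<Sum>i\<in>{1..r}. (u i \<bullet> y) *\<^sub>R u i)"
      using orthonormal_span[OF v _ x] orthonormal_span[OF u _ y] by simp_all
    then show ?thesis using form[OF \<omega>, of ?z] unfolding P W N by (simp add: add.commute)
  qed
  have "\<bar>y \<bullet> (E \<omega> *v x)\<bar> \<le> 4 * s * norm x * norm y"
    if \<omega>: "\<omega> \<in> F" and x: "x \<in> span (v ` {1..r})" and y: "y \<in> span (u ` {1..r})" for \<omega> x y
  proof (cases "x = 0 \<or> y = 0")
    case True
    then show ?thesis by auto
  next
    case False
    \<comment> \<open>On unit vectors the lower bound is \<open>- 4 * s\<close>; applying it to
      \<open>?y\<close> and \<open>- ?y\<close> bounds the absolute value.\<close>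
    let ?x = "x /\<^sub>R norm x" and ?y = "y /\<^sub>R norm y"
    have "?x \<in> span (v ` {1..r})" "?y \<in> span (u ` {1..r})" "- ?y \<in> span (u ` {1..r})"
      using x y by (auto intro: span_scale span_neg)
    from low[OF \<omega> this(1,2)] low[OF \<omega> this(1,3)] False
    have "\<bar>?y \<bullet> (E \<omega> *v ?x)\<bar> \<le> 4 * s" by (simp add: abs_le_iff)
    moreover have "\<bar>?y \<bullet> (E \<omega> *v ?x)\<bar> = \<bar>y \<bullet> (E \<omega> *v x)\<bar> / (norm x * norm y)"
      by (simp add: matrix_vector_mult_scaleR abs_mult divide_inverse mult_ac)
    ultimately show ?thesis using False by (simp add: pos_divide_le_eq mult_ac)
  qed
  then show ?thesis using F by (intro bexI[of _ F]) (auto simp: card_Plus mult_2)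
qed

section \<open>Deterministic perturbation of singular vectors\<close>

text \<open>A statement about one singular triple \<open>s\<close>, \<open>u'\<close>,
  \<open>v'\<close> of \<open>A + E\<close>. Its parameters stand for
  \<open>\<rho> = \<sigma> j\<close>, \<open>\<kappa> = \<sigma> (j + 1)\<close>, the spectral norm
  \<open>e\<close>, the norm \<open>\<tau>\<close> of \<open>E\<close> on the singular subspaces,
  and the overlap \<open>S\<close> with the first \<open>j - 1\<close> vectors.\<close>

lemma singular_vector_perturbation:
  fixes A E :: "real^'n^'m"
  assumes u: "orthonormal_family {1..r} u" and v: "orthonormal_family {1..r} v"
    and A: "\<And>x y. y \<bullet> (A *v x) = (\<Sum>i\<in>{1..r}. \<sigma> i * (v i \<bullet> x) * (u i \<bullet> y))"
    and j: "1 \<le> j" "j \<le> r"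
    and tail: "\<And>i. i \<in> {j<..r} \<Longrightarrow> 0 \<le> \<sigma> i \<and> \<sigma> i \<le> \<kappa>"
    and unit: "norm u' = 1" "norm v' = 1"
    and sv: "(A + E) *v v' = s *\<^sub>R u'" "transpose (A + E) *v u' = s *\<^sub>R v'"
    and pos: "0 < \<rho>" "0 < \<delta>" "0 \<le> e" "0 \<le> \<tau>" "0 \<le> S"
    and s: "\<rho> / 2 \<le> s" "\<delta> / 2 \<le> s - \<kappa>"
    and e: "\<And>x y. \<bar>y \<bullet> (E *v x)\<bar> \<le> e * norm x * norm y"
    and \<tau>: "\<And>x y. x \<in> span (v ` {1..r}) \<Longrightarrow> y \<in> span (u ` {1..r}) \<Longrightarrow> \<bar>y \<bullet> (E *v x)\<bar> \<le> \<tau> * norm x * norm y"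
    and S: "(\<Sum>i\<in>{1..<j}. (v i \<bullet> v')\<^sup>2) \<le> S\<^sup>2"
  shows "sqrt (1 - (v j \<bullet> v')\<^sup>2) \<le> S + 2 * sqrt 2 * (\<tau> / \<delta>) + 4 * sqrt 2 * (e\<^sup>2 / (\<rho> * \<delta>)) + 2 * (e / \<rho>)"
proof -
  define \<alpha> where "\<alpha> = (\<lambda>i. v i \<bullet> v')"
  define \<beta> where "\<beta> = (\<lambda>i. u i \<bullet> u')"
  let ?J = "{j<..r}"
  define a where "a = (\<Sum>i\<in>?J. \<alpha> i *\<^sub>R v i)"
  define b where "b = (\<Sum>i\<in>?J. \<beta> i *\<^sub>R u i)"
  define vP where "vP = (\<Sum>i\<in>{1..r}. \<alpha> i *\<^sub>R v i)"
  define uP where "uP = (\<Sum>i\<in>{1..r}. \<beta> i *\<^sub>R u i)"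
  have J: "?J \<subseteq> {1..r}" by auto
  have s0: "0 < s" using s pos by linarith
  have dv: "1 = (\<Sum>i\<in>{1..r}. (\<alpha> i)\<^sup>2) + (norm (v' - vP))\<^sup>2"
    using orthonormal_decomp[OF v, of v'] unit by (simp add: \<alpha>_def vP_def)
  have du: "1 = (\<Sum>i\<in>{1..r}. (\<beta> i)\<^sup>2) + (norm (u' - uP))\<^sup>2"
    using orthonormal_decomp[OF u, of u'] unit by (simp add: \<beta>_def uP_def)
  have "(norm vP)\<^sup>2 = (\<Sum>i\<in>{1..r}. (\<alpha> i)\<^sup>2)" "(norm uP)\<^sup>2 = (\<Sum>i\<in>{1..r}. (\<beta> i)\<^sup>2)"
    unfolding vP_def uP_def using orthonormal_norm_sum[OF u] orthonormal_norm_sum[OF v] by auto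
  with dv du have "(norm vP)\<^sup>2 \<le> 1" "(norm uP)\<^sup>2 \<le> 1"
    using zero_le_power2[of "norm (v' - vP)"] zero_le_power2[of "norm (u' - uP)"] by linarith+
  then have nP: "norm vP \<le> 1" "norm uP \<le> 1" by (simp_all add: abs_square_le_1)
  have a2: "(norm a)\<^sup>2 = (\<Sum>i\<in>?J. (\<alpha> i)\<^sup>2)" and b2: "(norm b)\<^sup>2 = (\<Sum>i\<in>?J. (\<beta> i)\<^sup>2)"
    unfolding a_def b_def
    using orthonormal_norm_sum[OF orthonormal_family_subset[OF u J]]
      orthonormal_norm_sum[OF orthonormal_family_subset[OF v J]] by auto
  have left: "s * (y \<bullet> u') = y \<bullet> (A *v v') + y \<bullet> (E *v v')" for y
    using arg_cong[OF sv(1), of "(\<bullet>) y"] by (simp add: matrix_vector_mult_add_rdistrib inner_add_right)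
  have right: "s * (v' \<bullet> x) = u' \<bullet> (A *v x) + u' \<bullet> (E *v x)" for x
    using arg_cong[OF sv(2), of "\<lambda>z. z \<bullet> x"]
    by (simp only: inner_matrix_transpose) (simp add: matrix_vector_mult_add_rdistrib inner_add_right)
  \<comment> \<open>The residual is orthogonal to all \<open>v i\<close>, so \<open>A\<close> kills
    it, and testing the singular equation with it leaves only the noise.\<close>
  have perp_v: "norm (v' - vP) \<le> e / s"
  proof -
    let ?x = "v' - vP"
    have 0: "v i \<bullet> ?x = 0" if "i \<in> {1..r}" for i
      using orthonormal_inner_sum[OF v _ that, of \<alpha>] by (simp add: vP_def \<alpha>_def inner_diff_right)
    then have "u' \<bullet> (A *v ?x) = 0" unfolding A by (intro sum.neutral) simp
    moreover have "vP \<bullet> ?x = 0" using 0 by (simp add: vP_def inner_sum_left)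
    then have "v' \<bullet> ?x = (norm ?x)\<^sup>2" by (simp add: power2_norm_eq_inner inner_diff_left)
    ultimately have "s * (norm ?x)\<^sup>2 \<le> e * norm ?x"
      using right[of ?x] e[of u' ?x] unit by simp
    then have "s * norm ?x \<le> e" using pos by (cases "norm ?x = 0") (auto simp: power2_eq_square)
    then show ?thesis using s0 by (simp add: pos_le_divide_eq mult.commute)
  qed
  have perp_u: "norm (u' - uP) \<le> e / s"
  proof -
    let ?x = "u' - uP"
    have 0: "u i \<bullet> ?x = 0" if "i \<in> {1..r}" for i
      using orthonormal_inner_sum[OF u _ that, of \<beta>] by (simp add: uP_def \<beta>_def inner_diff_right)
    then have "?x \<bullet> (A *v v') = 0" unfolding A by (intro sum.neutral) simp
    moreover have "uP \<bullet> ?x = 0" using 0 by (simp add: uP_def inner_sum_left)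
    then have "?x \<bullet> u' = (norm ?x)\<^sup>2"
      by (simp add: power2_norm_eq_inner inner_diff_right inner_diff_left inner_commute)
    ultimately have "s * (norm ?x)\<^sup>2 \<le> e * norm ?x"
      using left[of ?x] e[of ?x v'] unit by simp
    then have "s * norm ?x \<le> e" using pos by (cases "norm ?x = 0") (auto simp: power2_eq_square)
    then show ?thesis using s0 by (simp add: pos_le_divide_eq mult.commute)
  qed
  have spans: "a \<in> span (v ` {1..r})" "vP \<in> span (v ` {1..r})"
    "b \<in> span (u ` {1..r})" "uP \<in> span (u ` {1..r})"
    unfolding a_def b_def vP_def uP_def using J by (auto intro!: span_sum intro: span_scale span_base)
  \<comment> \<open>The term \<open>\<tau>\<close> bounds the noise between the singular subspaces;
    \<open>e * (e / s)\<close> accounts for the residual of \<open>u'\<close> or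
    \<open>v'\<close>.\<close>
  define T where "T = \<tau> + e * (e / s)"
  have T0: "0 \<le> T" using pos s0 by (simp add: T_def)
  have Ea: "u' \<bullet> (E *v a) \<le> T * norm a"
  proof -
    have "u' \<bullet> (E *v a) = uP \<bullet> (E *v a) + (u' - uP) \<bullet> (E *v a)" by (simp add: inner_diff_left)
    also have "\<dots> \<le> \<tau> * norm a * norm uP + e * norm a * norm (u' - uP)"
      using \<tau>[OF spans(1,4)] e[of "u' - uP" a] by linarith
    also have "\<dots> \<le> \<tau> * norm a * 1 + e * norm a * (e / s)"
      using nP perp_u pos by (intro add_mono mult_left_mono) auto
    finally show ?thesis by (simp add: T_def algebra_simps)
  qed
  have Eb: "b \<bullet> (E *v v') \<le> T * norm b"
  proof -
    have "b \<bullet> (E *v v') = b \<bullet> (E *v vP) + b \<bullet> (E *v (v' - vP))"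
      by (simp add: matrix_vector_mult_diff_distrib inner_diff_right)
    also have "\<dots> \<le> \<tau> * norm vP * norm b + e * norm (v' - vP) * norm b"
      using \<tau>[OF spans(2,3)] e[of b "v' - vP"] by linarith
    also have "\<dots> \<le> \<tau> * 1 * norm b + e * (e / s) * norm b"
      using nP perp_v pos by (intro add_mono mult_left_mono mult_right_mono) auto
    finally show ?thesis by (simp add: T_def algebra_simps)
  qed
  have in_a: "v i \<bullet> a = (if i \<in> ?J then \<alpha> i else 0)" if "i \<in> {1..r}" for i
  proof -
    have "a = (\<Sum>k\<in>{1..r}. (if k \<in> ?J then \<alpha> k else 0) *\<^sub>R v k)"
      unfolding a_def using J by (intro sum.mono_neutral_cong_left) auto
    then show ?thesis
      using orthonormal_inner_sum[OF v _ that, of "\<lambda>k. if k \<in> ?J then \<alpha> k else 0"] by simp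
  qed
  have in_b: "u i \<bullet> b = (if i \<in> ?J then \<beta> i else 0)" if "i \<in> {1..r}" for i
  proof -
    have "b = (\<Sum>k\<in>{1..r}. (if k \<in> ?J then \<beta> k else 0) *\<^sub>R u k)"
      unfolding b_def using J by (intro sum.mono_neutral_cong_left) auto
    then show ?thesis
      using orthonormal_inner_sum[OF u _ that, of "\<lambda>k. if k \<in> ?J then \<beta> k else 0"] by simp
  qed
  have Aa: "u' \<bullet> (A *v a) = (\<Sum>i\<in>?J. \<sigma> i * \<alpha> i * \<beta> i)"
    unfolding A using J by (intro sum.mono_neutral_cong_right) (auto simp: in_a \<beta>_def)
  have Ab: "b \<bullet> (A *v v') = (\<Sum>i\<in>?J. \<sigma> i * \<alpha> i * \<beta> i)"
    unfolding A using J by (intro sum.mono_neutral_cong_right) (auto simp: in_b \<alpha>_def)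
  have va: "v' \<bullet> a = (norm a)\<^sup>2"
    unfolding a2 by (simp add: a_def inner_sum_right \<alpha>_def power2_eq_square inner_commute)
  have bu: "b \<bullet> u' = (norm b)\<^sup>2"
    unfolding b2 by (simp add: b_def inner_sum_left \<beta>_def power2_eq_square)
  have cross: "2 * (\<Sum>i\<in>?J. \<sigma> i * \<alpha> i * \<beta> i) \<le> \<kappa> * ((norm a)\<^sup>2 + (norm b)\<^sup>2)"
  proof -
    have "2 * (\<Sum>i\<in>?J. \<sigma> i * \<alpha> i * \<beta> i) = (\<Sum>i\<in>?J. \<sigma> i * (2 * \<alpha> i * \<beta> i))"
      by (simp add: sum_distrib_left mult_ac)
    also have "\<dots> \<le> (\<Sum>i\<in>?J. \<kappa> * ((\<alpha> i)\<^sup>2 + (\<beta> i)\<^sup>2))"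
    proof (rule sum_mono)
      fix i assume i: "i \<in> ?J"
      have "\<sigma> i * (2 * \<alpha> i * \<beta> i) \<le> \<sigma> i * ((\<alpha> i)\<^sup>2 + (\<beta> i)\<^sup>2)"
        using tail[OF i] sum_squares_bound by (intro mult_left_mono) auto
      also have "\<dots> \<le> \<kappa> * ((\<alpha> i)\<^sup>2 + (\<beta> i)\<^sup>2)" using tail[OF i] by (intro mult_right_mono) auto
      finally show "\<sigma> i * (2 * \<alpha> i * \<beta> i) \<le> \<kappa> * ((\<alpha> i)\<^sup>2 + (\<beta> i)\<^sup>2)" .
    qed
    finally show ?thesis by (simp add: a2 b2 sum.distrib flip: sum_distrib_left)
  qed
  \<comment> \<open>The equations couple \<open>a\<close> and \<open>b\<close> through
    \<open>cross\<close>, so both are estimated together, although only \<open>a\<close> enters the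
    conclusion.\<close>
  define n where "n = sqrt ((norm a)\<^sup>2 + (norm b)\<^sup>2)"
  have n2: "n\<^sup>2 = (norm a)\<^sup>2 + (norm b)\<^sup>2" and n0: "0 \<le> n" by (simp_all add: n_def)
  have an: "norm a \<le> n" unfolding n_def by (rule real_le_rsqrt) simp
  have sum_n: "norm a + norm b \<le> sqrt 2 * n"
  proof -
    have "(norm a + norm b)\<^sup>2 \<le> (sqrt 2 * n)\<^sup>2"
      using sum_squares_bound[of "norm a" "norm b"] by (simp add: power_mult_distrib n2 power2_sum)
    then show ?thesis using n0 by (meson mult_nonneg_nonneg power2_le_imp_le real_sqrt_ge_zero zero_le_numeral)
  qed
  \<comment> \<open>The sum of the two singular equations, tested with \<open>a\<close> on the right
    and \<open>b\<close> on the left.\<close>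
  have "(s - \<kappa>) * n\<^sup>2 \<le> T * norm a + T * norm b"
    using right[of a] left[of b] Ea Eb cross unfolding Aa Ab va bu n2 by (simp add: algebra_simps)
  also have "\<dots> \<le> T * (sqrt 2 * n)"
    using mult_left_mono[OF sum_n T0] by (simp add: algebra_simps)
  finally have "(s - \<kappa>) * n * n \<le> sqrt 2 * T * n" by (simp add: power2_eq_square mult_ac)
  then have "(s - \<kappa>) * n \<le> sqrt 2 * T"
    using n0 T0 by (cases "n = 0") (auto simp: mult_le_cancel_right)
  moreover have "\<delta> / 2 * n \<le> (s - \<kappa>) * n" using s(2) n0 by (rule mult_right_mono)
  ultimately have "\<delta> / 2 * n \<le> sqrt 2 * T" by linarith
  then have n_le: "n \<le> 2 * sqrt 2 * (T / \<delta>)" using pos by (simp add: field_simps)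
  have es: "e / s \<le> 2 * (e / \<rho>)"
  proof -
    have "e / s \<le> e / (\<rho> / 2)" using s(1) pos by (intro divide_left_mono) auto
    then show ?thesis by (simp add: mult.commute)
  qed
  have "T / \<delta> \<le> (\<tau> + e * (2 * (e / \<rho>))) / \<delta>"
    unfolding T_def using es pos by (intro divide_right_mono add_left_mono mult_left_mono) auto
  also have "\<dots> = \<tau> / \<delta> + 2 * (e\<^sup>2 / (\<rho> * \<delta>))"
    using pos by (simp add: field_simps power2_eq_square)
  finally have "2 * sqrt 2 * (T / \<delta>) \<le> 2 * sqrt 2 * (\<tau> / \<delta> + 2 * (e\<^sup>2 / (\<rho> * \<delta>)))"
    by (intro mult_left_mono) auto
  with n_le an have a_le: "norm a \<le> 2 * sqrt 2 * (\<tau> / \<delta>) + 4 * sqrt 2 * (e\<^sup>2 / (\<rho> * \<delta>))"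
    by (simp add: algebra_simps)
  \<comment> \<open>The squared sine is the total weight of \<open>v'\<close> off
    \<open>v j\<close>: the indices below \<open>j\<close>, those above \<open>j\<close>, and the
    residual.\<close>
  have split: "{1..r} = insert j ({1..<j} \<union> ?J)" using j by auto
  have "(\<Sum>i\<in>{1..r}. (\<alpha> i)\<^sup>2) = (\<alpha> j)\<^sup>2 + ((\<Sum>i\<in>{1..<j}. (\<alpha> i)\<^sup>2) + (\<Sum>i\<in>?J. (\<alpha> i)\<^sup>2))"
    unfolding split by (subst sum.insert, simp, simp, subst sum.union_disjoint) auto
  then have "1 - (v j \<bullet> v')\<^sup>2 \<le> S\<^sup>2 + (norm a)\<^sup>2 + (norm (v' - vP))\<^sup>2"
    using dv S unfolding a2 \<alpha>_def by linarith
  also have "\<dots> \<le> (S + norm a + norm (v' - vP))\<^sup>2"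
    using pos by (simp add: power2_eq_square algebra_simps)
  finally have "sqrt (1 - (v j \<bullet> v')\<^sup>2) \<le> S + norm a + norm (v' - vP)"
    using pos by (intro real_le_lsqrt) auto
  then show ?thesis using a_le perp_v es by linarith
qed

text \<open>The bound on \<open>\<sigma>' j\<close> supplies what the preceding estimate asks of
  \<open>s\<close>, and the earlier angles supply its \<open>S\<close>. Since
  \<open>\<delta>\<close> and \<open>\<sigma> j\<close> are positive, all quotients are
  finite.\<close>

lemma sin_singular_vector_bound:
  fixes A E :: "real^'n^'m"
  assumes ss: "singular_system A \<sigma> u v" and ss': "singular_system (A + E) \<sigma>' u' v'"
    and j: "1 \<le> j" "j \<le> rank A"
    and gap: "0 < \<delta>" "\<delta> = \<sigma> j - \<sigma> (j + 1)" "\<sigma> j - \<delta> / 2 \<le> \<sigma>' j"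
    and pos: "0 \<le> e" "0 \<le> \<tau>"
    and e: "\<And>x y. \<bar>y \<bullet> (E *v x)\<bar> \<le> e * norm x * norm y"
    and \<tau>: "\<And>x y. x \<in> span (v ` {1..rank A}) \<Longrightarrow> y \<in> span (u ` {1..rank A}) \<Longrightarrow>
      \<bar>y \<bullet> (E *v x)\<bar> \<le> \<tau> * norm x * norm y"
  shows "ereal (sin (line_angle (v j) (v' j))) \<le>
     ereal (4 * sqrt 2) * (ereal (sqrt (\<Sum>i\<in>{1..<j}. (sin (line_angle (v i) (v' i)))\<^sup>2))
       + quot_inf \<tau> \<delta> + quot_inf (e\<^sup>2) (\<sigma> j * \<delta>) + quot_inf e (\<sigma> j))"
proof -
  let ?m = "min CARD('m) CARD('n)"
  have s: "\<And>i. 1 \<le> i \<Longrightarrow> 0 \<le> \<sigma> i" "\<And>i k. 1 \<le> i \<Longrightarrow> i \<le> k \<Longrightarrow> \<sigma> k \<le> \<sigma> i"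
    "orthonormal_family {1..?m} u" "orthonormal_family {1..?m} v"
    using ss unfolding singular_system_def by auto
  have s': "orthonormal_family {1..?m} u'" "orthonormal_family {1..?m} v'"
    "\<And>i. i \<in> {1..?m} \<Longrightarrow> (A + E) *v v' i = \<sigma>' i *\<^sub>R u' i \<and> transpose (A + E) *v u' i = \<sigma>' i *\<^sub>R v' i"
    using ss' unfolding singular_system_def by auto
  have r: "rank A \<le> ?m" by (rule rank_bound)
  have on: "orthonormal_family {1..rank A} u" "orthonormal_family {1..rank A} v"
    using s r by (auto intro: orthonormal_family_subset)
  have jm: "i \<in> {1..?m}" if "i \<in> {1..j}" for i using that j r by auto
  have \<rho>: "0 < \<sigma> j" using singular_system_rank[OF ss] j by simp
  have one: "norm (v i) = 1" "norm (v' i) = 1" "norm (u' i) = 1" if "i \<in> {1..j}" for i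
    using s(4) s' jm[OF that] unfolding orthonormal_family_def by (auto simp: norm_eq_sqrt_inner)
  have sin2: "(sin (line_angle (v i) (v' i)))\<^sup>2 = 1 - (v i \<bullet> v' i)\<^sup>2" if "i \<in> {1..j}" for i
  proof -
    have "\<bar>v i \<bullet> v' i\<bar> \<le> 1" using Cauchy_Schwarz_ineq2[of "v i" "v' i"] one[OF that] by simp
    then have "(v i \<bullet> v' i)\<^sup>2 \<le> 1" by (simp add: abs_square_le_1)
    then show ?thesis using sin_line_angle[OF one(1)[OF that] one(2)[OF that]] by simp
  qed
  define S where "S = sqrt (\<Sum>i\<in>{1..<j}. (sin (line_angle (v i) (v' i)))\<^sup>2)"
  have S0: "0 \<le> S" by (simp add: S_def sum_nonneg)
  have S2: "(\<Sum>i\<in>{1..<j}. (v i \<bullet> v' j)\<^sup>2) \<le> S\<^sup>2"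
  proof -
    have "(v i \<bullet> v' j)\<^sup>2 \<le> (sin (line_angle (v i) (v' i)))\<^sup>2" if i: "i \<in> {1..<j}" for i
    proof -
      \<comment> \<open>Bessel for the unit vector \<open>v i\<close> against the pair
        \<open>v' i\<close>, \<open>v' j\<close> bounds the overlap with \<open>v' j\<close> by the
        squared sine at \<open>i\<close>.\<close>
      have "orthonormal_family {i, j} v'"
        using s'(2) i jm j by (auto intro: orthonormal_family_subset)
      from orthonormal_bessel[OF this, of "v i"] one(1)[of i] i
      show ?thesis by (subst sin2) (auto simp: inner_commute)
    qed
    then show ?thesis by (auto simp: S_def sum_nonneg intro: sum_mono)
  qed
  have "sqrt (1 - (v j \<bullet> v' j)\<^sup>2)
    \<le> S + 2 * sqrt 2 * (\<tau> / \<delta>) + 4 * sqrt 2 * (e\<^sup>2 / (\<sigma> j * \<delta>)) + 2 * (e / \<sigma> j)"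
  proof (rule singular_vector_perturbation[OF on, where A = A and E = E and u' = "u' j" and s = "\<sigma>' j"
        and \<sigma> = \<sigma> and \<kappa> = "\<sigma> (j + 1)"])
    show "y \<bullet> (A *v x) = (\<Sum>i\<in>{1..rank A}. \<sigma> i * (v i \<bullet> x) * (u i \<bullet> y))" for x y
      unfolding singular_system_expansion[OF ss]
    proof (rule sum.mono_neutral_right)
      show "\<forall>i\<in>{1..?m} - {1..rank A}. \<sigma> i * (v i \<bullet> x) * (u i \<bullet> y) = 0"
      proof
        fix i assume i: "i \<in> {1..?m} - {1..rank A}"
        then have "\<sigma> i = 0" using singular_system_rank[OF ss, of i] s(1)[of i] by fastforce
        then show "\<sigma> i * (v i \<bullet> x) * (u i \<bullet> y) = 0" by simp
      qed
    qed (use r in auto)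
    show "0 \<le> \<sigma> i \<and> \<sigma> i \<le> \<sigma> (j + 1)" if "i \<in> {j<..rank A}" for i using that s(1,2) by auto
    \<comment> \<open>The first bound uses \<open>\<delta> \<le> \<sigma> j\<close>, which holds
      because \<open>\<sigma> (j + 1)\<close> is nonnegative.\<close>
    show "\<sigma> j / 2 \<le> \<sigma>' j" "\<delta> / 2 \<le> \<sigma>' j - \<sigma> (j + 1)" using gap s(1)[of "j + 1"] by linarith+
  qed (use j one[of j] s'(3)[of j] jm[of j] \<rho> gap(1) pos S0 S2 e \<tau> in auto)
  also have "\<dots> \<le> 4 * sqrt 2 * (S + \<tau> / \<delta> + e\<^sup>2 / (\<sigma> j * \<delta>) + e / \<sigma> j)"
  proof -
    have "1 \<le> sqrt 2" by simp
    then have "1 \<le> 4 * sqrt 2" "2 \<le> 4 * sqrt 2" "2 * sqrt 2 \<le> 4 * sqrt 2" by linarith+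
    moreover have "0 \<le> e / \<sigma> j" "0 \<le> \<tau> / \<delta>" using pos \<rho> gap(1) by simp_all
    ultimately have "1 * S \<le> 4 * sqrt 2 * S" "2 * (e / \<sigma> j) \<le> 4 * sqrt 2 * (e / \<sigma> j)"
      "2 * sqrt 2 * (\<tau> / \<delta>) \<le> 4 * sqrt 2 * (\<tau> / \<delta>)"
      using S0 by (blast intro: mult_right_mono)+
    then show ?thesis unfolding distrib_left by linarith
  qed
  finally have "sqrt (1 - (v j \<bullet> v' j)\<^sup>2) \<le> 4 * sqrt 2 * (S + \<tau> / \<delta> + e\<^sup>2 / (\<sigma> j * \<delta>) + e / \<sigma> j)" .
  moreover have "sin (line_angle (v j) (v' j)) = sqrt (1 - (v j \<bullet> v' j)\<^sup>2)"
    using one[of j] j by (intro sin_line_angle) auto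
  moreover have "\<delta> \<noteq> 0" "\<sigma> j \<noteq> 0" using gap \<rho> by auto
  ultimately show ?thesis unfolding S_def by (simp add: quot_inf_def)
qed

section \<open>The random events and their combination\<close>

lemma measure_Int_ge:
  assumes "prob_space M" "F \<in> sets M" "G \<in> sets M"
  shows "measure M F + measure M G - 1 \<le> measure M (F \<inter> G)"
proof -
  interpret prob_space M by fact
  have "measure M (F \<union> G) = measure M F + measure M G - measure M (F \<inter> G)"
    using assms by (intro measure_Un3) (auto simp: fmeasurable_eq_sets)
  moreover have "measure M (F \<union> G) \<le> 1" by (rule prob_le_1)
  ultimately show ?thesis by linarith
qed

text \<open>With equal coefficients on both sides the form of \<open>A\<close> is diagonal with
  entries at least \<open>\<sigma> j\<close>, so the min-max bound applies with
  \<open>\<sigma> j - \<epsilon>\<close>.\<close>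

lemma singular_value_perturbation:
  fixes A E :: "real^'n^'m"
  assumes ss: "singular_system A \<sigma> u v" and ss': "singular_system (A + E) \<sigma>' u' v'"
    and j: "1 \<le> j" "j \<le> rank A"
    and form: "\<And>z. - \<epsilon> * (\<Sum>i\<in>{1..j}. (z i)\<^sup>2)
       \<le> (\<Sum>i\<in>{1..j}. z i *\<^sub>R u i) \<bullet> (E *v (\<Sum>i\<in>{1..j}. z i *\<^sub>R v i))"
  shows "\<sigma> j - \<epsilon> \<le> \<sigma>' j"
proof -
  let ?m = "min CARD('m) CARD('n)"
  have jm: "{1..j} \<subseteq> {1..?m}" using j rank_bound[of A] by auto
  have u: "orthonormal_family {1..j} u" and v: "orthonormal_family {1..j} v"
    and s: "\<And>i. i \<in> {1..j} \<Longrightarrow> \<sigma> j \<le> \<sigma> i" "\<And>i. i \<in> {1..j} \<Longrightarrow> A *v v i = \<sigma> i *\<^sub>R u i"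
    using ss jm unfolding singular_system_def by (auto intro: orthonormal_family_subset)
  show ?thesis
  proof (rule singular_value_lower_bound[OF ss' j(1) u v])
    fix z :: "nat \<Rightarrow> real"
    let ?x = "\<Sum>i\<in>{1..j}. z i *\<^sub>R v i" and ?y = "\<Sum>i\<in>{1..j}. z i *\<^sub>R u i"
    have "A *v ?x = (\<Sum>i\<in>{1..j}. z i *\<^sub>R (A *v v i))"
      by (simp add: linear_sum[OF matrix_vector_mul_linear] matrix_vector_mult_scaleR)
    also have "\<dots> = (\<Sum>i\<in>{1..j}. (z i * \<sigma> i) *\<^sub>R u i)"
      by (rule sum.cong) (simp_all add: s)
    finally have "?y \<bullet> (A *v ?x) = (\<Sum>i\<in>{1..j}. (z i * \<sigma> i) *\<^sub>R u i) \<bullet> ?y"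
      by (simp only: inner_commute)
    also have "\<dots> = (\<Sum>i\<in>{1..j}. (z i * \<sigma> i) * (u i \<bullet> ?y))"
      by (subst inner_sum_left) simp
    also have "\<dots> = (\<Sum>i\<in>{1..j}. \<sigma> i * (z i)\<^sup>2)"
      by (rule sum.cong)
        (simp_all only: orthonormal_inner_sum[OF u finite_atLeastAtMost] power2_eq_square mult_ac)
    also have "\<dots> \<ge> (\<Sum>i\<in>{1..j}. \<sigma> j * (z i)\<^sup>2)"
      using s by (intro sum_mono mult_right_mono) auto
    finally show "(\<sigma> j - \<epsilon>) * (\<Sum>i\<in>{1..j}. (z i)\<^sup>2) \<le> ?y \<bullet> ((A + E) *v ?x)"
      using form[of z]
      by (simp add: matrix_vector_mult_add_rdistrib inner_add_right left_diff_distrib flip: sum_distrib_left)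
  qed
qed

theorem theorem22:
  fixes M :: "'a measure"
    and E :: "'a \<Rightarrow> real^'n^'m"
    and A :: "real^'n^'m"
    and C\<^sub>1 c\<^sub>1 \<gamma> t \<delta> :: real
    and r j :: nat
    and \<sigma> :: "nat \<Rightarrow> real" and u :: "nat \<Rightarrow> real^'m" and v :: "nat \<Rightarrow> real^'n"
    and \<sigma>' :: "'a \<Rightarrow> nat \<Rightarrow> real" and u' :: "'a \<Rightarrow> nat \<Rightarrow> real^'m" and v' :: "'a \<Rightarrow> nat \<Rightarrow> real^'n"
  assumes "prob_space M"
    and "E \<in> borel_measurable M"
    and "C\<^sub>1 > 0" and "c\<^sub>1 > 0" and "\<gamma> > 0"
    and "concentrated M E C\<^sub>1 c\<^sub>1 \<gamma>"
    and "rank A = r"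
    and "1 \<le> j" and "j \<le> r"
    and "singular_system A \<sigma> u v"
    and "\<And>\<omega>. \<omega> \<in> space M \<Longrightarrow> singular_system (A + E \<omega>) (\<sigma>' \<omega>) (u' \<omega>) (v' \<omega>)"
    and "\<delta> = \<sigma> j - \<sigma> (j + 1)"
    and "t > 0"
  shows "holds_with_prob_ge M
           (\<lambda>\<omega>. ereal (sin (line_angle (v j) (v' \<omega> j))) \<le>
              ereal (4 * sqrt 2) *
              (ereal (sqrt (\<Sum>i\<in>{1..<j}. (sin (line_angle (v i) (v' \<omega> i)))\<^sup>2))
               + quot_inf (t * real r powr (1 / \<gamma>)) \<delta>
               + quot_inf ((spectral_norm (E \<omega>))\<^sup>2) (\<sigma> j * \<delta>)
               + quot_inf (spectral_norm (E \<omega>)) (\<sigma> j)))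
           (1 - 6 * C\<^sub>1 * 9 ^ j * exp (- c\<^sub>1 * (\<delta> powr \<gamma> / 8 powr \<gamma>))
              - 2 * C\<^sub>1 * 9 ^ (2 * r) * exp (- c\<^sub>1 * real r * (t powr \<gamma> / 4 powr \<gamma>)))
       \<and> holds_with_prob_ge M
           (\<lambda>\<omega>. ereal (sin (line_angle (u j) (u' \<omega> j))) \<le>
              ereal (4 * sqrt 2) *
              (ereal (sqrt (\<Sum>i\<in>{1..<j}. (sin (line_angle (u i) (u' \<omega> i)))\<^sup>2))
               + quot_inf (t * real r powr (1 / \<gamma>)) \<delta>
               + quot_inf ((spectral_norm (E \<omega>))\<^sup>2) (\<sigma> j * \<delta>)
               + quot_inf (spectral_norm (E \<omega>)) (\<sigma> j)))
           (1 - 6 * C\<^sub>1 * 9 ^ j * exp (- c\<^sub>1 * (\<delta> powr \<gamma> / 8 powr \<gamma>))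
              - 2 * C\<^sub>1 * 9 ^ (2 * r) * exp (- c\<^sub>1 * real r * (t powr \<gamma> / 4 powr \<gamma>)))"
proof -
  interpret prob_space M by fact
  have ss: "singular_system A \<sigma> u v" and ss': "\<And>\<omega>. \<omega> \<in> space M \<Longrightarrow>
      singular_system (A + E \<omega>) (\<sigma>' \<omega>) (u' \<omega>) (v' \<omega>)"
    and j: "1 \<le> j" "j \<le> rank A" and r: "rank A = r" by (fact | simp add: assms)+
  define \<tau> where "\<tau> = t * real r powr (1 / \<gamma>)"
  define p where "p = 1 - 6 * C\<^sub>1 * 9 ^ j * exp (- c\<^sub>1 * (\<delta> powr \<gamma> / 8 powr \<gamma>))
      - 2 * C\<^sub>1 * 9 ^ (2 * r) * exp (- c\<^sub>1 * real r * (t powr \<gamma> / 4 powr \<gamma>))"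
  define bd where "bd = (\<lambda>s \<omega>. ereal (4 * sqrt 2) * (ereal s + quot_inf \<tau> \<delta>
      + quot_inf ((spectral_norm (E \<omega>))\<^sup>2) (\<sigma> j * \<delta>) + quot_inf (spectral_norm (E \<omega>)) (\<sigma> j)))"
  have "\<exists>F\<in>sets M. p \<le> measure M F \<and> (\<forall>\<omega>\<in>F.
      ereal (sin (line_angle (v j) (v' \<omega> j)))
        \<le> bd (sqrt (\<Sum>i\<in>{1..<j}. (sin (line_angle (v i) (v' \<omega> i)))\<^sup>2)) \<omega> \<and>
      ereal (sin (line_angle (u j) (u' \<omega> j)))
        \<le> bd (sqrt (\<Sum>i\<in>{1..<j}. (sin (line_angle (u i) (u' \<omega> i)))\<^sup>2)) \<omega>)"
  proof (cases "\<delta> = 0")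
    \<comment> \<open>A vanishing gap makes the first quotient infinite and no other term is minus
      infinity, so the bound holds on the whole space.\<close>
    case True
    have "quot_inf x y \<noteq> - \<infinity>" for x y by (simp add: quot_inf_def)
    then have "bd s \<omega> = \<infinity>" for s \<omega> using True by (simp add: bd_def quot_inf_def)
    moreover have "p \<le> 1"
    proof -
      have "0 \<le> 6 * C\<^sub>1 * 9 ^ j * exp (- c\<^sub>1 * (\<delta> powr \<gamma> / 8 powr \<gamma>))"
        "0 \<le> 2 * C\<^sub>1 * 9 ^ (2 * r) * exp (- c\<^sub>1 * real r * (t powr \<gamma> / 4 powr \<gamma>))"
        using \<open>C\<^sub>1 > 0\<close> by simp_all
      then show ?thesis unfolding p_def by linarith
    qed
    ultimately show ?thesis by (intro bexI[of _ "space M"]) (auto simp: prob_space)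
  next
    case False
    then have \<delta>: "\<delta> > 0"
      using ss j \<open>\<delta> = \<sigma> j - \<sigma> (j + 1)\<close> unfolding singular_system_def
      by (metis diff_ge_0_iff_ge le_add1 order_less_le)
    have \<tau>: "\<tau> > 0" using \<open>t > 0\<close> j r by (simp add: \<tau>_def)
    have "orthonormal_family {1..r} u" "orthonormal_family {1..r} v"
      using ss rank_bound[of A] r unfolding singular_system_def
      by (auto intro: orthonormal_family_subset)
    then have onr: "orthonormal_family {1..r} u" "orthonormal_family {1..r} v"
      and on: "orthonormal_family {1..j} u" "orthonormal_family {1..j} v"
      using j r by (auto intro: orthonormal_family_subset)
    have "norm (\<Sum>i\<in>{1..j}. z i *\<^sub>R u i) * norm (\<Sum>i\<in>{1..j}. z i *\<^sub>R v i) \<le> 1 * (\<Sum>i\<in>{1..j}. (z i)\<^sup>2)" for z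
      using sum_squares_bound[of "norm (\<Sum>i\<in>{1..j}. z i *\<^sub>R u i)" "norm (\<Sum>i\<in>{1..j}. z i *\<^sub>R v i)"]
      unfolding orthonormal_norm_sum[OF on(1) finite_atLeastAtMost]
        orthonormal_norm_sum[OF on(2) finite_atLeastAtMost] by simp
    \<comment> \<open>The level \<open>\<delta> / 8\<close> becomes \<open>\<delta> / 2\<close>
      after the loss of the factor \<open>4\<close> from rounding, here with
      \<open>b = 1\<close>.\<close>
    from concentrated_quadratic_form[OF assms(1,2) _ assms(6) _ _ _ this, of "\<delta> / 8"]
    obtain F where F: "F \<in> sets M"
      "1 - C\<^sub>1 * 9 ^ j * exp (- c\<^sub>1 * (\<delta> / 8) powr \<gamma>) \<le> measure M F"
      "\<And>\<omega> z. \<omega> \<in> F \<Longrightarrow> - (\<delta> / 2) * (\<Sum>i\<in>{1..j}. (z i)\<^sup>2)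
        \<le> (\<Sum>i\<in>{1..j}. z i *\<^sub>R u i) \<bullet> (E \<omega> *v (\<Sum>i\<in>{1..j}. z i *\<^sub>R v i))"
      using \<delta> \<open>C\<^sub>1 > 0\<close> by auto
    from concentrated_bilinear_form[OF assms(1,2) _ assms(6) _ onr, of "\<tau> / 4"]
    obtain G where G: "G \<in> sets M"
      "1 - C\<^sub>1 * 9 ^ (2 * r) * exp (- c\<^sub>1 * (\<tau> / 4) powr \<gamma>) \<le> measure M G"
      "\<And>\<omega> x y. \<omega> \<in> G \<Longrightarrow> x \<in> span (v ` {1..r}) \<Longrightarrow> y \<in> span (u ` {1..r}) \<Longrightarrow>
         \<bar>y \<bullet> (E \<omega> *v x)\<bar> \<le> \<tau> * norm x * norm y"
      using \<tau> \<open>C\<^sub>1 > 0\<close> by auto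
    \<comment> \<open>The factor \<open>r powr (1 / \<gamma>)\<close> in \<open>\<tau>\<close>
      becomes the factor \<open>r\<close> in the exponent.\<close>
    have powr: "(\<delta> / 8) powr \<gamma> = \<delta> powr \<gamma> / 8 powr \<gamma>"
      "(\<tau> / 4) powr \<gamma> = real r * (t powr \<gamma> / 4 powr \<gamma>)"
      using \<delta> \<tau> \<open>t > 0\<close> \<open>\<gamma> > 0\<close> by (simp_all add: powr_divide \<tau>_def powr_mult powr_powr)
    \<comment> \<open>Each event fails with constant \<open>1\<close> in front of
      \<open>C\<^sub>1\<close>, within the claimed constants \<open>6\<close> and
      \<open>2\<close>.\<close>
    have "p \<le> measure M F + measure M G - 1"
    proof -
      have "C\<^sub>1 * 9 ^ j * exp (- c\<^sub>1 * (\<delta> / 8) powr \<gamma>) \<ge> 0"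
        "C\<^sub>1 * 9 ^ (2 * r) * exp (- c\<^sub>1 * (\<tau> / 4) powr \<gamma>) \<ge> 0"
        using \<open>C\<^sub>1 > 0\<close> by simp_all
      then show ?thesis using F(2) G(2) unfolding p_def powr mult.assoc by linarith
    qed
    also have "\<dots> \<le> measure M (F \<inter> G)" by (rule measure_Int_ge) fact+
    finally have "p \<le> measure M (F \<inter> G)" .
    moreover have "ereal (sin (line_angle (v j) (v' \<omega> j)))
          \<le> bd (sqrt (\<Sum>i\<in>{1..<j}. (sin (line_angle (v i) (v' \<omega> i)))\<^sup>2)) \<omega>" (is ?V)
      and "ereal (sin (line_angle (u j) (u' \<omega> j)))
          \<le> bd (sqrt (\<Sum>i\<in>{1..<j}. (sin (line_angle (u i) (u' \<omega> i)))\<^sup>2)) \<omega>" (is ?U)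
      if \<omega>: "\<omega> \<in> F \<inter> G" for \<omega>
    proof -
      have \<omega>M: "\<omega> \<in> space M" using \<omega> F(1) sets.sets_into_space by blast
      have gap: "\<sigma> j - \<delta> / 2 \<le> \<sigma>' \<omega> j"
        by (rule singular_value_perturbation[OF ss ss'[OF \<omega>M] j]) (use F(3) \<omega> in blast)
      have e: "\<bar>y \<bullet> (E \<omega> *v x)\<bar> \<le> spectral_norm (E \<omega>) * norm x * norm y" for x y
      proof -
        have "\<bar>y \<bullet> (E \<omega> *v x)\<bar> \<le> norm y * norm (E \<omega> *v x)" by (rule Cauchy_Schwarz_ineq2)
        also have "\<dots> \<le> norm y * (spectral_norm (E \<omega>) * norm x)"
          unfolding spectral_norm_def by (intro mult_left_mono onorm) auto
        finally show ?thesis by (simp add: mult_ac)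
      qed
      have e0: "0 \<le> spectral_norm (E \<omega>)"
        unfolding spectral_norm_def by (intro onorm_pos_le) auto
      show ?V
        unfolding bd_def
        using \<tau> \<omega> by (intro sin_singular_vector_bound[OF ss ss'[OF \<omega>M] j \<delta> assms(12) gap e0 _ e])
          (auto simp: r intro: G(3))
      \<comment> \<open>Left singular vectors are the right ones of the transpose. The singular
        values agree, so the same event and the same \<open>gap\<close> serve both sides.\<close>
      have ts: "singular_system (transpose A + transpose (E \<omega>)) (\<sigma>' \<omega>) (v' \<omega>) (u' \<omega>)"
      proof -
        have "transpose A + transpose (E \<omega>) = transpose (A + E \<omega>)"
          by (simp add: vec_eq_iff transpose_def)
        then show ?thesis using singular_system_transpose[OF ss'[OF \<omega>M]] by simp
      qed
      have swap: "y \<bullet> (transpose (E \<omega>) *v x) = x \<bullet> (E \<omega> *v y)" for x y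
        by (simp only: inner_matrix_transpose inner_commute[of y])
      have tj: "j \<le> rank (transpose A)" using j by (simp add: rank_transpose)
      show ?U
        unfolding bd_def
      proof (rule sin_singular_vector_bound[OF singular_system_transpose[OF ss] ts j(1) tj \<delta> assms(12) gap e0])
        show "\<bar>y \<bullet> (transpose (E \<omega>) *v x)\<bar> \<le> spectral_norm (E \<omega>) * norm x * norm y" for x y
          unfolding swap using e[of x y] by (simp add: mult_ac)
        show "\<bar>y \<bullet> (transpose (E \<omega>) *v x)\<bar> \<le> \<tau> * norm x * norm y"
          if "x \<in> span (u ` {1..rank (transpose A)})" "y \<in> span (v ` {1..rank (transpose A)})" for x y
          using G(3)[of \<omega> y x] \<omega> that unfolding swap by (simp add: rank_transpose r mult_ac)
      qed (use \<tau> in simp)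
    qed
    ultimately show ?thesis using F(1) G(1) by (intro bexI[of _ "F \<inter> G"]) auto
  qed
  then obtain F where "F \<in> sets M" "p \<le> measure M F" and "\<And>\<omega>. \<omega> \<in> F \<Longrightarrow>
      ereal (sin (line_angle (v j) (v' \<omega> j)))
        \<le> bd (sqrt (\<Sum>i\<in>{1..<j}. (sin (line_angle (v i) (v' \<omega> i)))\<^sup>2)) \<omega> \<and>
      ereal (sin (line_angle (u j) (u' \<omega> j)))
        \<le> bd (sqrt (\<Sum>i\<in>{1..<j}. (sin (line_angle (u i) (u' \<omega> i)))\<^sup>2)) \<omega>" by blast
  then show ?thesis
    unfolding holds_with_prob_ge_def p_def[symmetric] \<tau>_def[symmetric] bd_def by blast
qed

end
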